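(* Let $(B,D,d,\theta)$ be a crossed module, let $\mathbb P=\mathbb P_{B\to D}$ be its associated Gr-category, let $Q$ be a group and let $\psi:Q\to\mathrm{Coker}\,d$ be a group homomorphism. Then there is a bijection $$\Omega:\mathrm{Hom}_{(\psi,0)}[\mathrm{Dis}\,Q,\mathbb P]\to\mathrm{Ext}_{B\to D}(Q,B,\psi).$$
   Context: **Crossed modules.** A crossed module is a quadruple $(B,D,d,\theta)$, also written $B\xrightarrow{d}D$, where $d:B\to D$ and $\theta:D\to\mathrm{Aut}(B)$ are group homomorphisms with $\theta\circ d=\mu$ (where $\mu_b$ is conjugation by $b$ on $B$) and $d(\theta_x(b))=x\,d(b)\,x^{-1}$ for $x\in D$, $b\in B$. The group $B$ (not necessarily abelian) is written additively, $D$ multiplicatively. $\mathrm{Im}\,d$ is normal in $D$, and $\mathrm{Coker}\,d=D/\mathrm{Im}\,d$ with canonical map $q:D\to\mathrm{Coker}\,d$. A morphism $(f_1,f_0):(B,D,d,\theta)\to(B',D',d',\theta')$ consists of group homomorphisms $f_1:B\to B'$, $f_0:D\to D'$ with $f_0d=d'f_1$ and $f_1(\theta_xb)=\theta'_{f_0(x)}f_1(b)$ for all $x\in D$, $b\in B$. **Extensions.** A group extension of $B$ by $Q$ of type $d:B\to D$ consists of a short exact sequence of groups $0\to B\xrightarrow{j}E\xrightarrow{p}Q\to1$ and a homomorphism $\varepsilon:E\to D$ such that $(id_B,\varepsilon)$ is a morphism of crossed modules from $(B,E,j,\theta')$ to $(B,D,d,\theta)$, where $\theta'$ is the action of $E$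 on $B\cong j(B)$ by conjugation; in particular $\varepsilon j=d$. It induces the unique homomorphism $\psi:Q\to\mathrm{Coker}\,d$ with $\psi p=q\varepsilon$. Two such extensions $(E,j,p,\varepsilon)$, $(E',j',p',\varepsilon')$ are equivalent if there is a homomorphism $\eta:E\to E'$ with $\eta j=j'$, $p'\eta=p$ and $\varepsilon'\eta=\varepsilon$. $\mathrm{Ext}_{B\to D}(Q,B,\psi)$ is the set of equivalence classes of extensions of $B$ by $Q$ of type $B\to D$ inducing $\psi$. **Gr-categories and Gr-functors.** A Gr-category is a monoidal category in which every morphism is invertible and every object has a weak inverse with respect to $\otimes$. A Gr-functor $(F,\widetilde F)$ between Gr-categories is a monoidal functor $(F,\widetilde F,F_\ast)$, with natural isomorphisms $\widetilde F_{X,Y}:FX\otimes FY\to F(X\otimes Y)$ and an isomorphism $F_\ast:I'\to FI$ satisfying the usual coherence conditions ($F_\ast$ is determined by $F$ and $\widetilde F$, so it is omitted). Two Gr-functors are homotopic if there is a monoidal natural isomorphism between them. **The Gr-categories $\mathbb P$ and $\mathrm{Dis}\,Q$.** $\mathbb P=\mathbb P_{B\to D}$ is the strict Gr-category with $\mathrm{Ob}(\mathbb P)=D$, $\mathrm{Hom}(x,y)=\{b\in B:x=d(b)y\}$, composition $(x\xrightarrow{b}y\xrightarrow{c}z)=(x\xrightarrow{b+c}z)$, tensor product on objects the multiplication of $D$, and on morphisms $(x\xrightarrow{b}y)\otimes(x'\xrightarrow{b'}y')=(xx'\xrightarrow{b+\theta_yb'}yy')$; the constraints are identities. The group of isomorphism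 classes of objects of $\mathbb P$ is $\pi_0\mathbb P=\mathrm{Coker}\,d$ and $\pi_1\mathbb P=\mathrm{Aut}(1)=\mathrm{Ker}\,d$. $\mathrm{Dis}\,Q$ is the strict Gr-category whose objects are the elements of $Q$, whose only morphisms are identities, and whose tensor product is the multiplication of $Q$; thus $\pi_0(\mathrm{Dis}\,Q)=Q$ and $\pi_1(\mathrm{Dis}\,Q)=0$. **Type.** A Gr-functor $(F,\widetilde F):\mathrm{Dis}\,Q\to\mathbb P$ is of type $(\psi,0)$ if the map it induces on $\pi_0$, $u\mapsto[F(u)]$, is $\psi:Q\to\mathrm{Coker}\,d$ (the map on $\pi_1$ is necessarily $0$). $\mathrm{Hom}_{(\psi,0)}[\mathrm{Dis}\,Q,\mathbb P]$ is the set of homotopy classes of Gr-functors $\mathrm{Dis}\,Q\to\mathbb P$ of type $(\psi,0)$. *)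

theory Defs
  imports "HOL-Algebra.Coset" "HOL-Algebra.Bij" "HOL-Algebra.Weak_Morphisms"
begin

section \<open>Crossed modules\<close>

text \<open>Both groups are multiplicative \<open>HOL-Algebra\<close> groups; what is written \<open>b + c\<close> in \<open>B\<close>
  informally is \<open>b \<otimes>\<^bsub>B\<^esub> c\<close> here. The elements of \<^term>\<open>carrier (AutoGroup B)\<close> are the automorphisms
  of \<open>B\<close>, normalised to be \<^term>\<open>undefined\<close> off the carrier.\<close>

locale crossed_module = B: group B + D: group D
  for B :: "('b, 'm) monoid_scheme" and D :: "('d, 'n) monoid_scheme"
    and d :: "'b \<Rightarrow> 'd" and \<theta> :: "'d \<Rightarrow> 'b \<Rightarrow> 'b" +
  assumes d_hom: "d \<in> hom B D"
    and theta_hom: "\<theta> \<in> hom D (AutoGroup B)"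
    and theta_d: "\<lbrakk>b \<in> carrier B; c \<in> carrier B\<rbrakk> \<Longrightarrow> \<theta> (d b) c = b \<otimes>\<^bsub>B\<^esub> c \<otimes>\<^bsub>B\<^esub> inv\<^bsub>B\<^esub> b"
    and d_theta: "\<lbrakk>x \<in> carrier D; b \<in> carrier B\<rbrakk> \<Longrightarrow> d (\<theta> x b) = x \<otimes>\<^bsub>D\<^esub> d b \<otimes>\<^bsub>D\<^esub> inv\<^bsub>D\<^esub> x"

definition coker :: "('b, 'm) monoid_scheme \<Rightarrow> ('d, 'n) monoid_scheme \<Rightarrow> ('b \<Rightarrow> 'd) \<Rightarrow> 'd set monoid"
  where "coker B D d = D Mod (d ` carrier B)"

definition coker_map :: "('b, 'm) monoid_scheme \<Rightarrow> ('d, 'n) monoid_scheme \<Rightarrow> ('b \<Rightarrow> 'd) \<Rightarrow> 'd \<Rightarrow> 'd set"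
  where "coker_map B D d x = (d ` carrier B) #>\<^bsub>D\<^esub> x"

definition crossed_module_morphism ::
  "('b, 'm) monoid_scheme \<Rightarrow> ('d, 'n) monoid_scheme \<Rightarrow> ('b \<Rightarrow> 'd) \<Rightarrow> ('d \<Rightarrow> 'b \<Rightarrow> 'b) \<Rightarrow>
   ('b1, 'm1) monoid_scheme \<Rightarrow> ('d1, 'n1) monoid_scheme \<Rightarrow> ('b1 \<Rightarrow> 'd1) \<Rightarrow> ('d1 \<Rightarrow> 'b1 \<Rightarrow> 'b1) \<Rightarrow>
   ('b \<Rightarrow> 'b1) \<Rightarrow> ('d \<Rightarrow> 'd1) \<Rightarrow> bool"
  where "crossed_module_morphism B D d \<theta> B' D' d' \<theta>' f\<^sub>1 f\<^sub>0 \<longleftrightarrow>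
     crossed_module B D d \<theta> \<and> crossed_module B' D' d' \<theta>' \<and>
     f\<^sub>1 \<in> hom B B' \<and> f\<^sub>0 \<in> hom D D' \<and>
     (\<forall>b\<in>carrier B. f\<^sub>0 (d b) = d' (f\<^sub>1 b)) \<and>
     (\<forall>x\<in>carrier D. \<forall>b\<in>carrier B. f\<^sub>1 (\<theta> x b) = \<theta>' (f\<^sub>0 x) (f\<^sub>1 b))"


section \<open>Extensions of the type of a crossed module\<close>

record ('b, 'e, 'q, 'd) extension_data =
  mid :: "'e monoid"
  emb :: "'b \<Rightarrow> 'e"
  prj :: "'e \<Rightarrow> 'q"
  eps :: "'e \<Rightarrow> 'd"

definition short_exact ::
  "('b, 'm) monoid_scheme \<Rightarrow> ('b \<Rightarrow> 'e) \<Rightarrow> ('e, 'l) monoid_scheme \<Rightarrow> ('e \<Rightarrow> 'q) \<Rightarrow> ('q, 'k) monoid_scheme \<Rightarrow> bool"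
  where "short_exact B j E p Q \<longleftrightarrow>
     group B \<and> group E \<and> group Q \<and> j \<in> hom B E \<and> p \<in> hom E Q \<and>
     inj_on j (carrier B) \<and> j ` carrier B = kernel E Q p \<and> p ` carrier E = carrier Q"

text \<open>The action of \<open>E\<close> on \<open>B \<cong> j(B)\<close> by conjugation, pulled back to \<open>B\<close> along \<open>j\<close>. By lemma
  \<open>short_exact_crossed_module\<close> below it makes \<open>j : B \<rightarrow> E\<close> a crossed module.\<close>

definition conj_action ::
  "('b, 'm) monoid_scheme \<Rightarrow> ('e, 'l) monoid_scheme \<Rightarrow> ('b \<Rightarrow> 'e) \<Rightarrow> 'e \<Rightarrow> 'b \<Rightarrow> 'b"
  where "conj_action B E j =
     (\<lambda>e. \<lambda>b\<in>carrier B. inv_into (carrier B) j (e \<otimes>\<^bsub>E\<^esub> j b \<otimes>\<^bsub>E\<^esub> inv\<^bsub>E\<^esub> e))"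

definition extension ::
  "('b, 'm) monoid_scheme \<Rightarrow> ('d, 'n) monoid_scheme \<Rightarrow> ('b \<Rightarrow> 'd) \<Rightarrow> ('d \<Rightarrow> 'b \<Rightarrow> 'b) \<Rightarrow>
   ('q, 'k) monoid_scheme \<Rightarrow> ('b, 'e, 'q, 'd) extension_data \<Rightarrow> bool"
  where "extension B D d \<theta> Q X \<longleftrightarrow>
     short_exact B (emb X) (mid X) (prj X) Q \<and>
     crossed_module_morphism
       B (mid X) (emb X) (conj_action B (mid X) (emb X))
       B D d \<theta> id (eps X)"

definition induces ::
  "('b, 'm) monoid_scheme \<Rightarrow> ('d, 'n) monoid_scheme \<Rightarrow> ('b \<Rightarrow> 'd) \<Rightarrow> ('b, 'e, 'q, 'd) extension_data \<Rightarrow> ('q \<Rightarrow> 'd set) \<Rightarrow> bool"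
  where "induces B D d X \<psi> \<longleftrightarrow> (\<forall>e\<in>carrier (mid X). \<psi> (prj X e) = coker_map B D d (eps X e))"

text \<open>Equivalence is stated for middle groups over possibly different types.\<close>

definition extension_equiv ::
  "('b, 'm) monoid_scheme \<Rightarrow> ('b, 'e, 'q, 'd) extension_data \<Rightarrow> ('b, 'f, 'q, 'd) extension_data \<Rightarrow> bool"
  where "extension_equiv B X Y \<longleftrightarrow>
     (\<exists>\<eta>\<in>hom (mid X) (mid Y).
        (\<forall>b\<in>carrier B. \<eta> (emb X b) = emb Y b) \<and>
        (\<forall>e\<in>carrier (mid X). prj Y (\<eta> e) = prj X e) \<and>
        (\<forall>e\<in>carrier (mid X). eps Y (\<eta> e) = eps X e))"

definition extensions ::
  "('b, 'm) monoid_scheme \<Rightarrow> ('d, 'n) monoid_scheme \<Rightarrow> ('b \<Rightarrow> 'd) \<Rightarrow> ('d \<Rightarrow> 'b \<Rightarrow> 'b) \<Rightarrow>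
   ('q, 'k) monoid_scheme \<Rightarrow> ('q \<Rightarrow> 'd set) \<Rightarrow> ('b, 'e, 'q, 'd) extension_data set"
  where "extensions B D d \<theta> Q \<psi> = {X. extension B D d \<theta> Q X \<and> induces B D d X \<psi>}"

definition extension_rel ::
  "('b, 'm) monoid_scheme \<Rightarrow> ('d, 'n) monoid_scheme \<Rightarrow> ('b \<Rightarrow> 'd) \<Rightarrow> ('d \<Rightarrow> 'b \<Rightarrow> 'b) \<Rightarrow>
   ('q, 'k) monoid_scheme \<Rightarrow> ('q \<Rightarrow> 'd set) \<Rightarrow> ('b, 'e, 'q, 'd) extension_data rel"
  where "extension_rel B D d \<theta> Q \<psi> =
     {(X, Y). X \<in> extensions B D d \<theta> Q \<psi> \<and> Y \<in> extensions B D d \<theta> Q \<psi> \<and> extension_equiv B X Y}"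

text \<open>A set of equivalence classes needs a fixed type for the middle groups. The underlying set of
  an extension of \<open>B\<close> by \<open>Q\<close> is in bijection with \<open>B \<times> Q\<close>, so the type \<^typ>\<open>'b \<times> 'q\<close> is large
  enough: lemma \<open>extension_small\<close> below shows that an extension whose middle group has elements of
  an arbitrary type is equivalent to one over \<^typ>\<open>'b \<times> 'q\<close>.\<close>

definition Ext ::
  "('b, 'm) monoid_scheme \<Rightarrow> ('d, 'n) monoid_scheme \<Rightarrow> ('b \<Rightarrow> 'd) \<Rightarrow> ('d \<Rightarrow> 'b \<Rightarrow> 'b) \<Rightarrow>
   ('q, 'k) monoid_scheme \<Rightarrow> ('q \<Rightarrow> 'd set) \<Rightarrow> ('b, 'b \<times> 'q, 'q, 'd) extension_data set set"
  where "Ext B D d \<theta> Q \<psi> = extensions B D d \<theta> Q \<psi> // extension_rel B D d \<theta> Q \<psi>"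


section \<open>Monoidal categories and Gr-categories\<close>

text \<open>Composition is in diagrammatic order: \<open>f \<Zsemi>\<^bsub>C\<^esub> g\<close> is \<open>f\<close> followed by \<open>g\<close>.
  Associativity constraints go from \<open>X \<otimes> (Y \<otimes> Z)\<close> to \<open>(X \<otimes> Y) \<otimes> Z\<close>.\<close>

record ('o, 'a) moncat =
  Obj :: "'o set"
  Arr :: "'a set"
  Dom :: "'a \<Rightarrow> 'o"
  Cod :: "'a \<Rightarrow> 'o"
  Idt :: "'o \<Rightarrow> 'a"
  Cmp :: "'a \<Rightarrow> 'a \<Rightarrow> 'a"  (infixl \<open>\<Zsemi>\<index>\<close> 65)
  TenO :: "'o \<Rightarrow> 'o \<Rightarrow> 'o"  (infixl \<open>\<odot>\<index>\<close> 70)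
  TenA :: "'a \<Rightarrow> 'a \<Rightarrow> 'a"  (infixl \<open>\<circledast>\<index>\<close> 70)
  Unt :: "'o"
  Asc :: "'o \<Rightarrow> 'o \<Rightarrow> 'o \<Rightarrow> 'a"
  Lun :: "'o \<Rightarrow> 'a"
  Run :: "'o \<Rightarrow> 'a"

definition Hom :: "('o, 'a) moncat \<Rightarrow> 'o \<Rightarrow> 'o \<Rightarrow> 'a set"
  where "Hom C X Y = {f \<in> Arr C. Dom C f = X \<and> Cod C f = Y}"

definition Iso :: "('o, 'a) moncat \<Rightarrow> 'o \<Rightarrow> 'o \<Rightarrow> 'a set"
  where "Iso C X Y =
    {f \<in> Hom C X Y. \<exists>g\<in>Hom C Y X. f \<Zsemi>\<^bsub>C\<^esub> g = Idt C X \<and> g \<Zsemi>\<^bsub>C\<^esub> f = Idt C Y}"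

definition iso_class :: "('o, 'a) moncat \<Rightarrow> 'o \<Rightarrow> 'o set"
  where "iso_class C X = {Y \<in> Obj C. Iso C X Y \<noteq> {}}"

locale small_category =
  fixes C :: "('o, 'a) moncat" (structure)
  assumes Dom_closed: "f \<in> Arr C \<Longrightarrow> Dom C f \<in> Obj C"
    and Cod_closed: "f \<in> Arr C \<Longrightarrow> Cod C f \<in> Obj C"
    and Idt_closed: "X \<in> Obj C \<Longrightarrow> Idt C X \<in> Hom C X X"
    and Cmp_closed: "\<lbrakk>f \<in> Hom C X Y; g \<in> Hom C Y Z\<rbrakk> \<Longrightarrow> f \<Zsemi> g \<in> Hom C X Z"
    and Idt_Cmp: "f \<in> Hom C X Y \<Longrightarrow> Idt C X \<Zsemi> f = f"
    and Cmp_Idt: "f \<in> Hom C X Y \<Longrightarrow> f \<Zsemi> Idt C Y = f"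
    and Cmp_assoc: "\<lbrakk>f \<in> Hom C W X; g \<in> Hom C X Y; h \<in> Hom C Y Z\<rbrakk> \<Longrightarrow>
      (f \<Zsemi> g) \<Zsemi> h = f \<Zsemi> (g \<Zsemi> h)"

locale monoidal_category = small_category C for C :: "('o, 'a) moncat" (structure) +
  assumes TenO_closed: "\<lbrakk>X \<in> Obj C; Y \<in> Obj C\<rbrakk> \<Longrightarrow> X \<odot> Y \<in> Obj C"
    and Unt_closed: "Unt C \<in> Obj C"
    and TenA_closed: "\<lbrakk>f \<in> Hom C X Y; f' \<in> Hom C X' Y'\<rbrakk> \<Longrightarrow> f \<circledast> f' \<in> Hom C (X \<odot> X') (Y \<odot> Y')"
    and TenA_Idt: "\<lbrakk>X \<in> Obj C; Y \<in> Obj C\<rbrakk> \<Longrightarrow> Idt C X \<circledast> Idt C Y = Idt C (X \<odot> Y)"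
    and TenA_Cmp: "\<lbrakk>f \<in> Hom C X Y; g \<in> Hom C Y Z; f' \<in> Hom C X' Y'; g' \<in> Hom C Y' Z'\<rbrakk> \<Longrightarrow>
      (f \<Zsemi> g) \<circledast> (f' \<Zsemi> g') = (f \<circledast> f') \<Zsemi> (g \<circledast> g')"
    and Asc_Iso: "\<lbrakk>X \<in> Obj C; Y \<in> Obj C; Z \<in> Obj C\<rbrakk> \<Longrightarrow>
      Asc C X Y Z \<in> Iso C (X \<odot> (Y \<odot> Z)) ((X \<odot> Y) \<odot> Z)"
    and Asc_natural: "\<lbrakk>f \<in> Hom C X X'; g \<in> Hom C Y Y'; h \<in> Hom C Z Z'\<rbrakk> \<Longrightarrow>
      (f \<circledast> (g \<circledast> h)) \<Zsemi> Asc C X' Y' Z' = Asc C X Y Z \<Zsemi> ((f \<circledast> g) \<circledast> h)"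
    and Lun_Iso: "X \<in> Obj C \<Longrightarrow> Lun C X \<in> Iso C (Unt C \<odot> X) X"
    and Lun_natural: "f \<in> Hom C X Y \<Longrightarrow> (Idt C (Unt C) \<circledast> f) \<Zsemi> Lun C Y = Lun C X \<Zsemi> f"
    and Run_Iso: "X \<in> Obj C \<Longrightarrow> Run C X \<in> Iso C (X \<odot> Unt C) X"
    and Run_natural: "f \<in> Hom C X Y \<Longrightarrow> (f \<circledast> Idt C (Unt C)) \<Zsemi> Run C Y = Run C X \<Zsemi> f"
    and pentagon: "\<lbrakk>W \<in> Obj C; X \<in> Obj C; Y \<in> Obj C; Z \<in> Obj C\<rbrakk> \<Longrightarrow>
      (Idt C W \<circledast> Asc C X Y Z) \<Zsemi> Asc C W (X \<odot> Y) Z \<Zsemi> (Asc C W X Y \<circledast> Idt C Z)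
      = Asc C W X (Y \<odot> Z) \<Zsemi> Asc C (W \<odot> X) Y Z"
    and triangle: "\<lbrakk>X \<in> Obj C; Y \<in> Obj C\<rbrakk> \<Longrightarrow>
      Asc C X (Unt C) Y \<Zsemi> (Run C X \<circledast> Idt C Y) = Idt C X \<circledast> Lun C Y"

locale gr_category = monoidal_category C for C :: "('o, 'a) moncat" (structure) +
  assumes Hom_Iso: "f \<in> Hom C X Y \<Longrightarrow> f \<in> Iso C X Y"
    and weak_inverse: "X \<in> Obj C \<Longrightarrow>
      \<exists>Y\<in>Obj C. Iso C (X \<odot> Y) (Unt C) \<noteq> {} \<and> Iso C (Y \<odot> X) (Unt C) \<noteq> {}"


section \<open>Gr-functors and homotopies\<close>

record ('o, 'a, 'p, 'c) monfun =
  FunO :: "'o \<Rightarrow> 'p"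
  FunA :: "'a \<Rightarrow> 'c"
  FunT :: "'o \<Rightarrow> 'o \<Rightarrow> 'c"
  FunU :: "'c"

locale monoidal_functor = C: monoidal_category C + C': monoidal_category C'
  for C :: "('o, 'a) moncat" and C' :: "('p, 'c) moncat" and F :: "('o, 'a, 'p, 'c) monfun" +
  assumes FunO_closed: "X \<in> Obj C \<Longrightarrow> FunO F X \<in> Obj C'"
    and FunA_closed: "f \<in> Hom C X Y \<Longrightarrow> FunA F f \<in> Hom C' (FunO F X) (FunO F Y)"
    and FunA_Idt: "X \<in> Obj C \<Longrightarrow> FunA F (Idt C X) = Idt C' (FunO F X)"
    and FunA_Cmp: "\<lbrakk>f \<in> Hom C X Y; g \<in> Hom C Y Z\<rbrakk> \<Longrightarrow>
      FunA F (f \<Zsemi>\<^bsub>C\<^esub> g) = FunA F f \<Zsemi>\<^bsub>C'\<^esub> FunA F g"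
    and FunT_Iso: "\<lbrakk>X \<in> Obj C; Y \<in> Obj C\<rbrakk> \<Longrightarrow>
      FunT F X Y \<in> Iso C' (FunO F X \<odot>\<^bsub>C'\<^esub> FunO F Y) (FunO F (X \<odot>\<^bsub>C\<^esub> Y))"
    and FunT_natural: "\<lbrakk>f \<in> Hom C X X'; g \<in> Hom C Y Y'\<rbrakk> \<Longrightarrow>
      (FunA F f \<circledast>\<^bsub>C'\<^esub> FunA F g) \<Zsemi>\<^bsub>C'\<^esub> FunT F X' Y' = FunT F X Y \<Zsemi>\<^bsub>C'\<^esub> FunA F (f \<circledast>\<^bsub>C\<^esub> g)"
    and FunU_Iso: "FunU F \<in> Iso C' (Unt C') (FunO F (Unt C))"
    and FunT_assoc: "\<lbrakk>X \<in> Obj C; Y \<in> Obj C; Z \<in> Obj C\<rbrakk> \<Longrightarrow>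
      (Idt C' (FunO F X) \<circledast>\<^bsub>C'\<^esub> FunT F Y Z) \<Zsemi>\<^bsub>C'\<^esub> FunT F X (Y \<odot>\<^bsub>C\<^esub> Z) \<Zsemi>\<^bsub>C'\<^esub> FunA F (Asc C X Y Z)
      = Asc C' (FunO F X) (FunO F Y) (FunO F Z) \<Zsemi>\<^bsub>C'\<^esub>
        (FunT F X Y \<circledast>\<^bsub>C'\<^esub> Idt C' (FunO F Z)) \<Zsemi>\<^bsub>C'\<^esub> FunT F (X \<odot>\<^bsub>C\<^esub> Y) Z"
    and FunT_lunit: "X \<in> Obj C \<Longrightarrow>
      (FunU F \<circledast>\<^bsub>C'\<^esub> Idt C' (FunO F X)) \<Zsemi>\<^bsub>C'\<^esub> FunT F (Unt C) X \<Zsemi>\<^bsub>C'\<^esub> FunA F (Lun C X)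
      = Lun C' (FunO F X)"
    and FunT_runit: "X \<in> Obj C \<Longrightarrow>
      (Idt C' (FunO F X) \<circledast>\<^bsub>C'\<^esub> FunU F) \<Zsemi>\<^bsub>C'\<^esub> FunT F X (Unt C) \<Zsemi>\<^bsub>C'\<^esub> FunA F (Run C X)
      = Run C' (FunO F X)"

definition gr_functor :: "('o, 'a) moncat \<Rightarrow> ('p, 'c) moncat \<Rightarrow> ('o, 'a, 'p, 'c) monfun \<Rightarrow> bool"
  where "gr_functor C C' F \<longleftrightarrow> gr_category C \<and> gr_category C' \<and> monoidal_functor C C' F"

definition monoidal_nat_iso ::
  "('o, 'a) moncat \<Rightarrow> ('p, 'c) moncat \<Rightarrow> ('o, 'a, 'p, 'c) monfun \<Rightarrow> ('o, 'a, 'p, 'c) monfun \<Rightarrow>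
   ('o \<Rightarrow> 'c) \<Rightarrow> bool"
  where "monoidal_nat_iso C C' F G \<alpha> \<longleftrightarrow>
    (\<forall>X\<in>Obj C. \<alpha> X \<in> Iso C' (FunO F X) (FunO G X)) \<and>
    (\<forall>X\<in>Obj C. \<forall>Y\<in>Obj C. \<forall>f\<in>Hom C X Y. FunA F f \<Zsemi>\<^bsub>C'\<^esub> \<alpha> Y = \<alpha> X \<Zsemi>\<^bsub>C'\<^esub> FunA G f) \<and>
    (\<forall>X\<in>Obj C. \<forall>Y\<in>Obj C.
       FunT F X Y \<Zsemi>\<^bsub>C'\<^esub> \<alpha> (X \<odot>\<^bsub>C\<^esub> Y) = (\<alpha> X \<circledast>\<^bsub>C'\<^esub> \<alpha> Y) \<Zsemi>\<^bsub>C'\<^esub> FunT G X Y) \<and>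
    FunU F \<Zsemi>\<^bsub>C'\<^esub> \<alpha> (Unt C) = FunU G"

definition homotopic ::
  "('o, 'a) moncat \<Rightarrow> ('p, 'c) moncat \<Rightarrow> ('o, 'a, 'p, 'c) monfun \<Rightarrow> ('o, 'a, 'p, 'c) monfun \<Rightarrow> bool"
  where "homotopic C C' F G \<longleftrightarrow> (\<exists>\<alpha>. monoidal_nat_iso C C' F G \<alpha>)"


section \<open>The Gr-categories \<open>\<P>\<close> and \<open>Dis Q\<close>\<close>

text \<open>The morphism \<open>x \<rightarrow> y\<close> given by \<open>b\<close> is the triple \<open>(x, b, y)\<close>.\<close>

definition PP ::
  "('b, 'm) monoid_scheme \<Rightarrow> ('d, 'n) monoid_scheme \<Rightarrow> ('b \<Rightarrow> 'd) \<Rightarrow> ('d \<Rightarrow> 'b \<Rightarrow> 'b) \<Rightarrow>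
   ('d, 'd \<times> 'b \<times> 'd) moncat"
  where "PP B D d \<theta> =
    \<lparr>Obj = carrier D,
     Arr = {(x, b, y). x \<in> carrier D \<and> b \<in> carrier B \<and> y \<in> carrier D \<and> x = d b \<otimes>\<^bsub>D\<^esub> y},
     Dom = (\<lambda>(x, b, y). x),
     Cod = (\<lambda>(x, b, y). y),
     Idt = (\<lambda>x. (x, \<one>\<^bsub>B\<^esub>, x)),
     Cmp = (\<lambda>(x, b, y) (y', c, z). (x, b \<otimes>\<^bsub>B\<^esub> c, z)),
     TenO = (\<lambda>x y. x \<otimes>\<^bsub>D\<^esub> y),
     TenA = (\<lambda>(x, b, y) (x', b', y'). (x \<otimes>\<^bsub>D\<^esub> x', b \<otimes>\<^bsub>B\<^esub> \<theta> y b', y \<otimes>\<^bsub>D\<^esub> y')),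
     Unt = \<one>\<^bsub>D\<^esub>,
     Asc = (\<lambda>x y z. (x \<otimes>\<^bsub>D\<^esub> (y \<otimes>\<^bsub>D\<^esub> z), \<one>\<^bsub>B\<^esub>, x \<otimes>\<^bsub>D\<^esub> y \<otimes>\<^bsub>D\<^esub> z)),
     Lun = (\<lambda>x. (\<one>\<^bsub>D\<^esub> \<otimes>\<^bsub>D\<^esub> x, \<one>\<^bsub>B\<^esub>, x)),
     Run = (\<lambda>x. (x \<otimes>\<^bsub>D\<^esub> \<one>\<^bsub>D\<^esub>, \<one>\<^bsub>B\<^esub>, x))\<rparr>"

text \<open>The only morphisms are identities, so a morphism is represented by its object.\<close>

definition Dis :: "('q, 'k) monoid_scheme \<Rightarrow> ('q, 'q) moncat"
  where "Dis Q =
    \<lparr>Obj = carrier Q,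
     Arr = carrier Q,
     Dom = (\<lambda>u. u),
     Cod = (\<lambda>u. u),
     Idt = (\<lambda>u. u),
     Cmp = (\<lambda>u v. u),
     TenO = (\<lambda>u v. u \<otimes>\<^bsub>Q\<^esub> v),
     TenA = (\<lambda>u v. u \<otimes>\<^bsub>Q\<^esub> v),
     Unt = \<one>\<^bsub>Q\<^esub>,
     Asc = (\<lambda>u v w. u \<otimes>\<^bsub>Q\<^esub> v \<otimes>\<^bsub>Q\<^esub> w),
     Lun = (\<lambda>u. u),
     Run = (\<lambda>u. u)\<rparr>"

text \<open>By lemma \<open>iso_class_PP\<close> below, the isomorphism class of an object \<open>x\<close> of \<open>\<P>\<close> is the coset
  \<open>q(x)\<close>, so \<open>iso_class\<close> takes values in \<open>Coker d\<close>.\<close>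

definition gr_functors_of_type ::
  "('b, 'm) monoid_scheme \<Rightarrow> ('d, 'n) monoid_scheme \<Rightarrow> ('b \<Rightarrow> 'd) \<Rightarrow> ('d \<Rightarrow> 'b \<Rightarrow> 'b) \<Rightarrow>
   ('q, 'k) monoid_scheme \<Rightarrow> ('q \<Rightarrow> 'd set) \<Rightarrow> ('q, 'q, 'd, 'd \<times> 'b \<times> 'd) monfun set"
  where "gr_functors_of_type B D d \<theta> Q \<psi> =
     {F. gr_functor (Dis Q) (PP B D d \<theta>) F \<and>
         (\<forall>u\<in>carrier Q. iso_class (PP B D d \<theta>) (FunO F u) = \<psi> u)}"

definition homotopy_rel ::
  "('b, 'm) monoid_scheme \<Rightarrow> ('d, 'n) monoid_scheme \<Rightarrow> ('b \<Rightarrow> 'd) \<Rightarrow> ('d \<Rightarrow> 'b \<Rightarrow> 'b) \<Rightarrow>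
   ('q, 'k) monoid_scheme \<Rightarrow> ('q \<Rightarrow> 'd set) \<Rightarrow> ('q, 'q, 'd, 'd \<times> 'b \<times> 'd) monfun rel"
  where "homotopy_rel B D d \<theta> Q \<psi> =
     {(F, G). F \<in> gr_functors_of_type B D d \<theta> Q \<psi> \<and> G \<in> gr_functors_of_type B D d \<theta> Q \<psi> \<and>
        homotopic (Dis Q) (PP B D d \<theta>) F G}"

definition Hom_Dis_PP ::
  "('b, 'm) monoid_scheme \<Rightarrow> ('d, 'n) monoid_scheme \<Rightarrow> ('b \<Rightarrow> 'd) \<Rightarrow> ('d \<Rightarrow> 'b \<Rightarrow> 'b) \<Rightarrow>
   ('q, 'k) monoid_scheme \<Rightarrow> ('q \<Rightarrow> 'd set) \<Rightarrow> ('q, 'q, 'd, 'd \<times> 'b \<times> 'd) monfun set set"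
  where "Hom_Dis_PP B D d \<theta> Q \<psi> = gr_functors_of_type B D d \<theta> Q \<psi> // homotopy_rel B D d \<theta> Q \<psi>"

section \<open>Well-definedness\<close>

context crossed_module
begin

lemma d_closed [simp]: "b \<in> carrier B \<Longrightarrow> d b \<in> carrier D"
  using d_hom by (auto simp: hom_def)

lemma d_mult: "\<lbrakk>b \<in> carrier B; c \<in> carrier B\<rbrakk> \<Longrightarrow> d (b \<otimes>\<^bsub>B\<^esub> c) = d b \<otimes>\<^bsub>D\<^esub> d c"
  using d_hom by (auto simp: hom_def)

lemma group_hom_d: "group_hom B D d"
  by unfold_locales (rule d_hom)

lemma d_one [simp]: "d \<one>\<^bsub>B\<^esub> = \<one>\<^bsub>D\<^esub>"
  by (rule group_hom.hom_one [OF group_hom_d])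

lemma d_inv: "b \<in> carrier B \<Longrightarrow> d (inv\<^bsub>B\<^esub> b) = inv\<^bsub>D\<^esub> (d b)"
  by (rule group_hom.hom_inv [OF group_hom_d])

lemma theta_auto: "x \<in> carrier D \<Longrightarrow> \<theta> x \<in> auto B"
  using theta_hom by (auto simp: hom_def AutoGroup_def)

lemma theta_closed [simp]: "\<lbrakk>x \<in> carrier D; b \<in> carrier B\<rbrakk> \<Longrightarrow> \<theta> x b \<in> carrier B"
  using theta_auto [of x] by (auto simp: auto_def hom_def)

lemma theta_mult: "\<lbrakk>x \<in> carrier D; b \<in> carrier B; c \<in> carrier B\<rbrakk> \<Longrightarrow>
    \<theta> x (b \<otimes>\<^bsub>B\<^esub> c) = \<theta> x b \<otimes>\<^bsub>B\<^esub> \<theta> x c"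
  using theta_auto [of x] by (auto simp: auto_def hom_def)

lemma theta_one [simp]: "x \<in> carrier D \<Longrightarrow> \<theta> x \<one>\<^bsub>B\<^esub> = \<one>\<^bsub>B\<^esub>"
  using theta_mult [of x "\<one>\<^bsub>B\<^esub>" "\<one>\<^bsub>B\<^esub>"] by simp

lemma theta_comp: "\<lbrakk>x \<in> carrier D; y \<in> carrier D; b \<in> carrier B\<rbrakk> \<Longrightarrow>
    \<theta> (x \<otimes>\<^bsub>D\<^esub> y) b = \<theta> x (\<theta> y b)"
proof -
  assume a: "x \<in> carrier D" "y \<in> carrier D" "b \<in> carrier B"
  have "\<theta> (x \<otimes>\<^bsub>D\<^esub> y) = \<theta> x \<otimes>\<^bsub>AutoGroup B\<^esub> \<theta> y"
    using theta_hom a by (auto simp: hom_def)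
  also have "\<dots> = compose (carrier B) (\<theta> x) (\<theta> y)"
    using theta_auto a by (auto simp: AutoGroup_def BijGroup_def auto_def)
  finally show ?thesis using a by (simp add: compose_def)
qed

lemma theta_id [simp]: "b \<in> carrier B \<Longrightarrow> \<theta> \<one>\<^bsub>D\<^esub> b = b"
  using theta_d [of "\<one>\<^bsub>B\<^esub>" b] by simp

lemma subgroup_image: "subgroup (d ` carrier B) D"
  by (rule group_hom.img_is_subgroup [OF group_hom_d])

lemma normal_image: "d ` carrier B \<lhd> D"
proof -
  have "x \<otimes>\<^bsub>D\<^esub> h \<otimes>\<^bsub>D\<^esub> inv\<^bsub>D\<^esub> x \<in> d ` carrier B" if "x \<in> carrier D" "h \<in> d ` carrier B" for x h
    using that d_theta [of x] by (auto simp flip: d_theta)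
  then show ?thesis
    by (simp add: D.normal_inv_iff subgroup_image)
qed

lemma Hom_PP: "Hom (PP B D d \<theta>) x y =
    {(x', b, y'). x' = x \<and> y' = y \<and> x \<in> carrier D \<and> b \<in> carrier B \<and> y \<in> carrier D \<and> x = d b \<otimes>\<^bsub>D\<^esub> y}"
  by (auto simp: Hom_def PP_def)

lemma Hom_PP_I: "\<lbrakk>x \<in> carrier D; b \<in> carrier B; y \<in> carrier D; x = d b \<otimes>\<^bsub>D\<^esub> y\<rbrakk> \<Longrightarrow>
    (x, b, y) \<in> Hom (PP B D d \<theta>) x y"
  by (simp add: Hom_PP)

lemma Hom_PP_E:
  assumes "f \<in> Hom (PP B D d \<theta>) x y"
  obtains b where "f = (x, b, y)" "x \<in> carrier D" "b \<in> carrier B" "y \<in> carrier D" "x = d b \<otimes>\<^bsub>D\<^esub> y"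
  using assms by (auto simp: Hom_PP)

lemma PP_simps [simp]:
  "Obj (PP B D d \<theta>) = carrier D"
  "Idt (PP B D d \<theta>) x = (x, \<one>\<^bsub>B\<^esub>, x)"
  "(x, b, y) \<Zsemi>\<^bsub>PP B D d \<theta>\<^esub> (y', c, z) = (x, b \<otimes>\<^bsub>B\<^esub> c, z)"
  "x \<odot>\<^bsub>PP B D d \<theta>\<^esub> y = x \<otimes>\<^bsub>D\<^esub> y"
  "(x, b, y) \<circledast>\<^bsub>PP B D d \<theta>\<^esub> (x', b', y') = (x \<otimes>\<^bsub>D\<^esub> x', b \<otimes>\<^bsub>B\<^esub> \<theta> y b', y \<otimes>\<^bsub>D\<^esub> y')"
  "Unt (PP B D d \<theta>) = \<one>\<^bsub>D\<^esub>"
  "Asc (PP B D d \<theta>) x y z = (x \<otimes>\<^bsub>D\<^esub> (y \<otimes>\<^bsub>D\<^esub> z), \<one>\<^bsub>B\<^esub>, x \<otimes>\<^bsub>D\<^esub> y \<otimes>\<^bsub>D\<^esub> z)"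
  "Lun (PP B D d \<theta>) x = (\<one>\<^bsub>D\<^esub> \<otimes>\<^bsub>D\<^esub> x, \<one>\<^bsub>B\<^esub>, x)"
  "Run (PP B D d \<theta>) x = (x \<otimes>\<^bsub>D\<^esub> \<one>\<^bsub>D\<^esub>, \<one>\<^bsub>B\<^esub>, x)"
  by (simp_all add: PP_def)

lemma Hom_PP_Cmp: "\<lbrakk>f \<in> Hom (PP B D d \<theta>) x y; g \<in> Hom (PP B D d \<theta>) y z\<rbrakk> \<Longrightarrow>
    f \<Zsemi>\<^bsub>PP B D d \<theta>\<^esub> g \<in> Hom (PP B D d \<theta>) x z"
  by (auto elim!: Hom_PP_E intro!: Hom_PP_I simp: d_mult D.m_assoc)

lemma Hom_PP_TenA:
  assumes "f \<in> Hom (PP B D d \<theta>) x y" "f' \<in> Hom (PP B D d \<theta>) x' y'"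
  shows "f \<circledast>\<^bsub>PP B D d \<theta>\<^esub> f' \<in> Hom (PP B D d \<theta>) (x \<otimes>\<^bsub>D\<^esub> x') (y \<otimes>\<^bsub>D\<^esub> y')"
proof -
  obtain b where b: "f = (x, b, y)" "x \<in> carrier D" "b \<in> carrier B" "y \<in> carrier D" "x = d b \<otimes>\<^bsub>D\<^esub> y"
    using assms(1) by (rule Hom_PP_E)
  obtain b' where b': "f' = (x', b', y')" "x' \<in> carrier D" "b' \<in> carrier B" "y' \<in> carrier D"
      "x' = d b' \<otimes>\<^bsub>D\<^esub> y'"
    using assms(2) by (rule Hom_PP_E)
  have "d (b \<otimes>\<^bsub>B\<^esub> \<theta> y b') \<otimes>\<^bsub>D\<^esub> (y \<otimes>\<^bsub>D\<^esub> y') = d b \<otimes>\<^bsub>D\<^esub> (y \<otimes>\<^bsub>D\<^esub> d b' \<otimes>\<^bsub>D\<^esub> (inv\<^bsub>D\<^esub> y \<otimes>\<^bsub>D\<^esub> y)) \<otimes>\<^bsub>D\<^esub> y'"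
    using b b' by (simp only: d_mult d_theta D.m_assoc D.m_closed D.inv_closed d_closed theta_closed)
  also have "\<dots> = d b \<otimes>\<^bsub>D\<^esub> y \<otimes>\<^bsub>D\<^esub> (d b' \<otimes>\<^bsub>D\<^esub> y')"
    using b b' by (simp add: D.m_assoc)
  finally show ?thesis
    using b b' by (simp add: Hom_PP)
qed

lemma Iso_PP: "Iso (PP B D d \<theta>) x y = Hom (PP B D d \<theta>) x y"
proof -
  have "\<exists>g\<in>Hom (PP B D d \<theta>) y x. f \<Zsemi>\<^bsub>PP B D d \<theta>\<^esub> g = Idt (PP B D d \<theta>) x
      \<and> g \<Zsemi>\<^bsub>PP B D d \<theta>\<^esub> f = Idt (PP B D d \<theta>) y"
    if f: "f \<in> Hom (PP B D d \<theta>) x y" for f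
  proof -
    obtain b where b: "f = (x, b, y)" "x \<in> carrier D" "b \<in> carrier B" "y \<in> carrier D" "x = d b \<otimes>\<^bsub>D\<^esub> y"
      using f by (rule Hom_PP_E)
    have y: "y = d (inv\<^bsub>B\<^esub> b) \<otimes>\<^bsub>D\<^esub> x"
      using b by (simp add: d_inv D.m_assoc [symmetric])
    have "(y, inv\<^bsub>B\<^esub> b, x) \<in> Hom (PP B D d \<theta>) y x"
      by (rule Hom_PP_I [OF b(4) B.inv_closed [OF b(3)] b(2) y])
    then show ?thesis
      by (rule rev_bexI) (simp add: b(1,3))
  qed
  then show ?thesis by (auto simp: Iso_def)
qed

lemma iso_class_PP:
  assumes x: "x \<in> carrier D"
  shows "iso_class (PP B D d \<theta>) x = coker_map B D d x"
proof (intro equalityI subsetI)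
  fix y assume "y \<in> iso_class (PP B D d \<theta>) x"
  then obtain b where b: "b \<in> carrier B" "y \<in> carrier D" "x = d b \<otimes>\<^bsub>D\<^esub> y"
    by (auto simp: iso_class_def Iso_PP elim: Hom_PP_E)
  then have "y = d (inv\<^bsub>B\<^esub> b) \<otimes>\<^bsub>D\<^esub> x"
    by (simp add: d_inv D.m_assoc [symmetric])
  then show "y \<in> coker_map B D d x"
    using b by (auto simp: coker_map_def r_coset_def)
next
  fix y assume "y \<in> coker_map B D d x"
  then obtain b where b: "b \<in> carrier B" "y = d b \<otimes>\<^bsub>D\<^esub> x"
    by (auto simp: coker_map_def r_coset_def)
  then have "(x, inv\<^bsub>B\<^esub> b, y) \<in> Hom (PP B D d \<theta>) x y"
    using x by (intro Hom_PP_I) (auto simp: d_inv D.m_assoc [symmetric])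
  then show "y \<in> iso_class (PP B D d \<theta>) x"
    using b x by (auto simp: iso_class_def Iso_PP)
qed

lemma interchange_PP:
  assumes "b \<in> carrier B" "c \<in> carrier B" "b' \<in> carrier B" "c' \<in> carrier B" "z \<in> carrier D"
    "y = d c \<otimes>\<^bsub>D\<^esub> z"
  shows "b \<otimes>\<^bsub>B\<^esub> c \<otimes>\<^bsub>B\<^esub> \<theta> z (b' \<otimes>\<^bsub>B\<^esub> c') = b \<otimes>\<^bsub>B\<^esub> \<theta> y b' \<otimes>\<^bsub>B\<^esub> (c \<otimes>\<^bsub>B\<^esub> \<theta> z c')"
proof -
  have "\<theta> y b' \<otimes>\<^bsub>B\<^esub> c = c \<otimes>\<^bsub>B\<^esub> \<theta> z b'"
    using assms by (simp add: theta_comp theta_d B.m_assoc)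
  moreover have "b \<otimes>\<^bsub>B\<^esub> \<theta> y b' \<otimes>\<^bsub>B\<^esub> (c \<otimes>\<^bsub>B\<^esub> \<theta> z c') = b \<otimes>\<^bsub>B\<^esub> (\<theta> y b' \<otimes>\<^bsub>B\<^esub> c) \<otimes>\<^bsub>B\<^esub> \<theta> z c'"
    using assms by (simp add: B.m_assoc)
  ultimately have "b \<otimes>\<^bsub>B\<^esub> \<theta> y b' \<otimes>\<^bsub>B\<^esub> (c \<otimes>\<^bsub>B\<^esub> \<theta> z c') = b \<otimes>\<^bsub>B\<^esub> (c \<otimes>\<^bsub>B\<^esub> \<theta> z b') \<otimes>\<^bsub>B\<^esub> \<theta> z c'"
    by (simp only:)
  then show ?thesis
    using assms by (simp add: theta_mult B.m_assoc)
qed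

theorem gr_category_PP: "gr_category (PP B D d \<theta>)"
proof (unfold_locales, goal_cases)
  case (1 f) then show ?case by (auto simp: PP_def)
next case (2 f) then show ?case by (auto simp: PP_def)
next case (3 X) then show ?case by (auto intro: Hom_PP_I)
next case 4 then show ?case by (rule Hom_PP_Cmp)
next case 5 then show ?case by (auto elim: Hom_PP_E)
next case 6 then show ?case by (auto elim: Hom_PP_E)
next case 7 then show ?case by (auto elim!: Hom_PP_E simp: B.m_assoc)
next case 8 then show ?case by simp
next case 9 then show ?case by simp
next case 10 then show ?case using Hom_PP_TenA by simp
next case 11 then show ?case by simp
next case 12 then show ?case
  by (elim Hom_PP_E) (simp only: PP_simps prod.inject interchange_PP simp_thms)
next case 13 then show ?case by (auto simp: Iso_PP D.m_assoc intro: Hom_PP_I)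
next case 14 then show ?case
  by (elim Hom_PP_E) (simp add: theta_mult theta_comp B.m_assoc D.m_assoc)
next case 15 then show ?case by (auto simp: Iso_PP intro: Hom_PP_I)
next case 16 then show ?case by (elim Hom_PP_E) simp
next case 17 then show ?case by (auto simp: Iso_PP intro: Hom_PP_I)
next case 18 then show ?case by (elim Hom_PP_E) simp
next case 19 then show ?case by (simp add: D.m_assoc)
next case 20 then show ?case by (simp add: D.m_assoc)
next case 21 then show ?case by (simp add: Iso_PP)
next case (22 x)
  then have "(x \<otimes>\<^bsub>D\<^esub> inv\<^bsub>D\<^esub> x, \<one>\<^bsub>B\<^esub>, \<one>\<^bsub>D\<^esub>) \<in> Hom (PP B D d \<theta>) (x \<otimes>\<^bsub>D\<^esub> inv\<^bsub>D\<^esub> x) \<one>\<^bsub>D\<^esub>"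
     "(inv\<^bsub>D\<^esub> x \<otimes>\<^bsub>D\<^esub> x, \<one>\<^bsub>B\<^esub>, \<one>\<^bsub>D\<^esub>) \<in> Hom (PP B D d \<theta>) (inv\<^bsub>D\<^esub> x \<otimes>\<^bsub>D\<^esub> x) \<one>\<^bsub>D\<^esub>"
    by (auto intro!: Hom_PP_I)
  with 22 show ?case
    by (intro bexI [of _ "inv\<^bsub>D\<^esub> x"]) (auto simp: Iso_PP)
qed

end

lemma Hom_Dis: "Hom (Dis Q) u v = (if u = v then {u} \<inter> carrier Q else {})"
  by (auto simp: Hom_def Dis_def)

lemma Dis_simps:
  "Obj (Dis Q) = carrier Q" "Arr (Dis Q) = carrier Q" "Dom (Dis Q) u = u" "Cod (Dis Q) u = u"
  "Idt (Dis Q) u = u" "u \<Zsemi>\<^bsub>Dis Q\<^esub> v = u"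
  "u \<odot>\<^bsub>Dis Q\<^esub> v = u \<otimes>\<^bsub>Q\<^esub> v" "u \<circledast>\<^bsub>Dis Q\<^esub> v = u \<otimes>\<^bsub>Q\<^esub> v" "Unt (Dis Q) = \<one>\<^bsub>Q\<^esub>"
  "Asc (Dis Q) u v w = u \<otimes>\<^bsub>Q\<^esub> v \<otimes>\<^bsub>Q\<^esub> w" "Lun (Dis Q) u = u" "Run (Dis Q) u = u"
  by (simp_all add: Dis_def)

lemma Iso_Dis: "Iso (Dis Q) u v = (if u = v then {u} \<inter> carrier Q else {})"
  by (auto simp: Iso_def Hom_Dis Dis_simps)

theorem (in group) gr_category_Dis: "gr_category (Dis G)"
proof (unfold_locales, goal_cases)
  case (22 u)
  then show ?case by (intro bexI [of _ "inv u"]) (simp_all add: Iso_Dis Dis_simps)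
qed (simp_all add: Hom_Dis Iso_Dis Dis_simps m_assoc split: if_splits)

lemma (in small_category) square_inverse:
  assumes a: "a \<in> Hom C X Y" "a' \<in> Hom C Y X" "a' \<Zsemi> a = Idt C Y"
    and c: "c \<in> Hom C Z W" "c' \<in> Hom C W Z" "c \<Zsemi> c' = Idt C Z"
    and f: "f \<in> Hom C X Z" and g: "g \<in> Hom C Y W" and sq: "f \<Zsemi> c = a \<Zsemi> g"
  shows "g \<Zsemi> c' = a' \<Zsemi> f"
proof -
  have "f = f \<Zsemi> (c \<Zsemi> c')"
    by (simp only: c(3) Cmp_Idt [OF f])
  also have "\<dots> = a \<Zsemi> (g \<Zsemi> c')"
    by (simp only: Cmp_assoc [OF f c(1,2), symmetric] sq Cmp_assoc [OF a(1) g c(2)])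
  finally have "a' \<Zsemi> f = a' \<Zsemi> (a \<Zsemi> (g \<Zsemi> c'))" by (rule arg_cong)
  also have "\<dots> = g \<Zsemi> c'"
    using Cmp_closed [OF g c(2)]
    by (simp only: Cmp_assoc [OF a(2,1), symmetric] a(3) Idt_Cmp)
  finally show ?thesis by (rule sym)
qed

lemma (in small_category) square_compose:
  assumes f: "f \<in> Hom C X Z" and g: "g \<in> Hom C X' Z'" and h: "h \<in> Hom C X'' Z''"
    and a: "a \<in> Hom C X X'" "a' \<in> Hom C X' X''" and c: "c \<in> Hom C Z Z'" "c' \<in> Hom C Z' Z''"
    and sq: "f \<Zsemi> c = a \<Zsemi> g" "g \<Zsemi> c' = a' \<Zsemi> h"
  shows "f \<Zsemi> (c \<Zsemi> c') = (a \<Zsemi> a') \<Zsemi> h"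
  by (simp only: Cmp_assoc [OF f c, symmetric] sq(1) Cmp_assoc [OF a(1) g c(2)] sq(2)
      Cmp_assoc [OF a h])

lemma (in small_category) Idt_Iso: "X \<in> Obj C \<Longrightarrow> Idt C X \<in> Iso C X X"
  using Idt_closed Idt_Cmp by (auto simp: Iso_def)

lemma (in small_category) Iso_Cmp:
  assumes "f \<in> Iso C X Y" "g \<in> Iso C Y Z"
  shows "f \<Zsemi> g \<in> Iso C X Z"
proof -
  obtain f' g' where
    f: "f \<in> Hom C X Y" "f' \<in> Hom C Y X" "f \<Zsemi> f' = Idt C X" "f' \<Zsemi> f = Idt C Y" and
    g: "g \<in> Hom C Y Z" "g' \<in> Hom C Z Y" "g \<Zsemi> g' = Idt C Y" "g' \<Zsemi> g = Idt C Z"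
    using assms by (auto simp: Iso_def)
  have "f \<Zsemi> g \<Zsemi> (g' \<Zsemi> f') = Idt C X"
    by (simp only: Cmp_assoc [OF f(1) g(1) Cmp_closed [OF g(2) f(2)]]
        Cmp_assoc [OF g(1,2) f(2), symmetric] g(3) Idt_Cmp [OF f(2)] f(3))
  moreover have "g' \<Zsemi> f' \<Zsemi> (f \<Zsemi> g) = Idt C Z"
    by (simp only: Cmp_assoc [OF g(2) f(2) Cmp_closed [OF f(1) g(1)]]
        Cmp_assoc [OF f(2,1) g(1), symmetric] f(4) Idt_Cmp [OF g(1)] g(4))
  ultimately show ?thesis
    using f g Cmp_closed by (auto simp: Iso_def)
qed

lemma Iso_Hom: "f \<in> Iso C X Y \<Longrightarrow> f \<in> Hom C X Y"
  by (simp add: Iso_def)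

lemma homotopic_refl:
  assumes "monoidal_functor C C' F"
  shows "homotopic C C' F F"
proof -
  interpret F: monoidal_functor C C' F by fact
  have T: "FunT F X Y \<in> Hom C' (FunO F X \<odot>\<^bsub>C'\<^esub> FunO F Y) (FunO F (X \<odot>\<^bsub>C\<^esub> Y))"
    if "X \<in> Obj C" "Y \<in> Obj C" for X Y
    using F.FunT_Iso that by (simp add: Iso_def)
  show ?thesis
    unfolding homotopic_def monoidal_nat_iso_def
  proof (intro exI [of _ "\<lambda>X. Idt C' (FunO F X)"] conjI ballI)
    fix X assume X: "X \<in> Obj C"
    then show "Idt C' (FunO F X) \<in> Iso C' (FunO F X) (FunO F X)"
      by (simp add: F.C'.Idt_Iso F.FunO_closed)
    fix Y assume Y: "Y \<in> Obj C"
    show "FunA F f \<Zsemi>\<^bsub>C'\<^esub> Idt C' (FunO F Y) = Idt C' (FunO F X) \<Zsemi>\<^bsub>C'\<^esub> FunA F f"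
      if "f \<in> Hom C X Y" for f
      by (simp only: F.C'.Cmp_Idt [OF F.FunA_closed [OF that]] F.C'.Idt_Cmp [OF F.FunA_closed [OF that]])
    show "FunT F X Y \<Zsemi>\<^bsub>C'\<^esub> Idt C' (FunO F (X \<odot>\<^bsub>C\<^esub> Y)) =
        (Idt C' (FunO F X) \<circledast>\<^bsub>C'\<^esub> Idt C' (FunO F Y)) \<Zsemi>\<^bsub>C'\<^esub> FunT F X Y"
      by (simp only: F.C'.TenA_Idt [OF F.FunO_closed [OF X] F.FunO_closed [OF Y]]
          F.C'.Cmp_Idt [OF T [OF X Y]] F.C'.Idt_Cmp [OF T [OF X Y]])
  next
    show "FunU F \<Zsemi>\<^bsub>C'\<^esub> Idt C' (FunO F (Unt C)) = FunU F"
      by (rule F.C'.Cmp_Idt [OF Iso_Hom [OF F.FunU_Iso]])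
  qed
qed

lemma homotopic_sym:
  assumes "monoidal_functor C C' F" "monoidal_functor C C' G" "homotopic C C' F G"
  shows "homotopic C C' G F"
proof -
  interpret F: monoidal_functor C C' F by fact
  interpret G: monoidal_functor C C' G by fact
  obtain \<alpha> where \<alpha>: "\<And>X. X \<in> Obj C \<Longrightarrow> \<alpha> X \<in> Iso C' (FunO F X) (FunO G X)"
    and nat: "\<And>X Y f. \<lbrakk>X \<in> Obj C; Y \<in> Obj C; f \<in> Hom C X Y\<rbrakk> \<Longrightarrow>
      FunA F f \<Zsemi>\<^bsub>C'\<^esub> \<alpha> Y = \<alpha> X \<Zsemi>\<^bsub>C'\<^esub> FunA G f"
    and mon: "\<And>X Y. \<lbrakk>X \<in> Obj C; Y \<in> Obj C\<rbrakk> \<Longrightarrow>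
      FunT F X Y \<Zsemi>\<^bsub>C'\<^esub> \<alpha> (X \<odot>\<^bsub>C\<^esub> Y) = (\<alpha> X \<circledast>\<^bsub>C'\<^esub> \<alpha> Y) \<Zsemi>\<^bsub>C'\<^esub> FunT G X Y"
    and unt: "FunU F \<Zsemi>\<^bsub>C'\<^esub> \<alpha> (Unt C) = FunU G"
    using assms(3) unfolding homotopic_def monoidal_nat_iso_def by blast
  have "\<exists>g. g \<in> Hom C' (FunO G X) (FunO F X) \<and>
      \<alpha> X \<Zsemi>\<^bsub>C'\<^esub> g = Idt C' (FunO F X) \<and> g \<Zsemi>\<^bsub>C'\<^esub> \<alpha> X = Idt C' (FunO G X)" if "X \<in> Obj C" for X
    using \<alpha> [OF that] by (auto simp: Iso_def)
  then obtain \<beta> where \<beta>: "\<And>X. X \<in> Obj C \<Longrightarrow> \<beta> X \<in> Hom C' (FunO G X) (FunO F X)"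
    "\<And>X. X \<in> Obj C \<Longrightarrow> \<alpha> X \<Zsemi>\<^bsub>C'\<^esub> \<beta> X = Idt C' (FunO F X)"
    "\<And>X. X \<in> Obj C \<Longrightarrow> \<beta> X \<Zsemi>\<^bsub>C'\<^esub> \<alpha> X = Idt C' (FunO G X)"
    by metis
  have \<alpha>H: "\<And>X. X \<in> Obj C \<Longrightarrow> \<alpha> X \<in> Hom C' (FunO F X) (FunO G X)"
    by (rule Iso_Hom [OF \<alpha>])
  show ?thesis
    unfolding homotopic_def monoidal_nat_iso_def
  proof (intro exI [of _ \<beta>] conjI ballI)
    fix X assume X: "X \<in> Obj C"
    then show "\<beta> X \<in> Iso C' (FunO G X) (FunO F X)"
      unfolding Iso_def by (simp add: \<beta>(1)) (rule bexI [OF _ \<alpha>H], simp_all add: \<beta>)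
    fix Y assume Y: "Y \<in> Obj C"
    show "FunA G f \<Zsemi>\<^bsub>C'\<^esub> \<beta> Y = \<beta> X \<Zsemi>\<^bsub>C'\<^esub> FunA F f" if "f \<in> Hom C X Y" for f
      by (rule F.C'.square_inverse [OF \<alpha>H \<beta>(1) \<beta>(3) \<alpha>H \<beta>(1) \<beta>(2) F.FunA_closed G.FunA_closed nat])
        (use X Y that in auto)
    have ab: "\<alpha> X \<circledast>\<^bsub>C'\<^esub> \<alpha> Y \<in> Hom C' (FunO F X \<odot>\<^bsub>C'\<^esub> FunO F Y) (FunO G X \<odot>\<^bsub>C'\<^esub> FunO G Y)"
      "\<beta> X \<circledast>\<^bsub>C'\<^esub> \<beta> Y \<in> Hom C' (FunO G X \<odot>\<^bsub>C'\<^esub> FunO G Y) (FunO F X \<odot>\<^bsub>C'\<^esub> FunO F Y)"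
      using X Y \<alpha>H \<beta> F.C'.TenA_closed by auto
    have "(\<beta> X \<circledast>\<^bsub>C'\<^esub> \<beta> Y) \<Zsemi>\<^bsub>C'\<^esub> (\<alpha> X \<circledast>\<^bsub>C'\<^esub> \<alpha> Y) = Idt C' (FunO G X) \<circledast>\<^bsub>C'\<^esub> Idt C' (FunO G Y)"
      by (simp only: F.C'.TenA_Cmp [OF \<beta>(1) \<alpha>H \<beta>(1) \<alpha>H, symmetric] X Y \<beta>(3))
    also have "\<dots> = Idt C' (FunO G X \<odot>\<^bsub>C'\<^esub> FunO G Y)"
      using X Y by (simp add: F.C'.TenA_Idt G.FunO_closed)
    finally have ba: "(\<beta> X \<circledast>\<^bsub>C'\<^esub> \<beta> Y) \<Zsemi>\<^bsub>C'\<^esub> (\<alpha> X \<circledast>\<^bsub>C'\<^esub> \<alpha> Y) = Idt C' (FunO G X \<odot>\<^bsub>C'\<^esub> FunO G Y)" .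
    show "FunT G X Y \<Zsemi>\<^bsub>C'\<^esub> \<beta> (X \<odot>\<^bsub>C\<^esub> Y) = (\<beta> X \<circledast>\<^bsub>C'\<^esub> \<beta> Y) \<Zsemi>\<^bsub>C'\<^esub> FunT F X Y"
      by (rule F.C'.square_inverse [OF ab ba \<alpha>H \<beta>(1) \<beta>(2) Iso_Hom [OF F.FunT_Iso] Iso_Hom [OF G.FunT_Iso] mon])
        (use X Y F.C.TenO_closed in auto)
  next
    show "FunU G \<Zsemi>\<^bsub>C'\<^esub> \<beta> (Unt C) = FunU F"
      by (simp only: unt [symmetric] \<beta>(2) [OF F.C.Unt_closed] F.C'.Cmp_Idt [OF Iso_Hom [OF F.FunU_Iso]]
          F.C'.Cmp_assoc [OF Iso_Hom [OF F.FunU_Iso] \<alpha>H [OF F.C.Unt_closed] \<beta>(1) [OF F.C.Unt_closed]])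
  qed
qed

lemma homotopic_trans:
  assumes "monoidal_functor C C' F" "monoidal_functor C C' G" "monoidal_functor C C' H"
    and "homotopic C C' F G" "homotopic C C' G H"
  shows "homotopic C C' F H"
proof -
  interpret F: monoidal_functor C C' F by fact
  interpret G: monoidal_functor C C' G by fact
  interpret H: monoidal_functor C C' H by fact
  obtain \<alpha> where \<alpha>: "\<And>X. X \<in> Obj C \<Longrightarrow> \<alpha> X \<in> Iso C' (FunO F X) (FunO G X)"
    and nat: "\<And>X Y f. \<lbrakk>X \<in> Obj C; Y \<in> Obj C; f \<in> Hom C X Y\<rbrakk> \<Longrightarrow>
      FunA F f \<Zsemi>\<^bsub>C'\<^esub> \<alpha> Y = \<alpha> X \<Zsemi>\<^bsub>C'\<^esub> FunA G f"
    and mon: "\<And>X Y. \<lbrakk>X \<in> Obj C; Y \<in> Obj C\<rbrakk> \<Longrightarrow>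
      FunT F X Y \<Zsemi>\<^bsub>C'\<^esub> \<alpha> (X \<odot>\<^bsub>C\<^esub> Y) = (\<alpha> X \<circledast>\<^bsub>C'\<^esub> \<alpha> Y) \<Zsemi>\<^bsub>C'\<^esub> FunT G X Y"
    and unt: "FunU F \<Zsemi>\<^bsub>C'\<^esub> \<alpha> (Unt C) = FunU G"
    using assms(4) unfolding homotopic_def monoidal_nat_iso_def by blast
  obtain \<beta> where \<beta>: "\<And>X. X \<in> Obj C \<Longrightarrow> \<beta> X \<in> Iso C' (FunO G X) (FunO H X)"
    and nat': "\<And>X Y f. \<lbrakk>X \<in> Obj C; Y \<in> Obj C; f \<in> Hom C X Y\<rbrakk> \<Longrightarrow>
      FunA G f \<Zsemi>\<^bsub>C'\<^esub> \<beta> Y = \<beta> X \<Zsemi>\<^bsub>C'\<^esub> FunA H f"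
    and mon': "\<And>X Y. \<lbrakk>X \<in> Obj C; Y \<in> Obj C\<rbrakk> \<Longrightarrow>
      FunT G X Y \<Zsemi>\<^bsub>C'\<^esub> \<beta> (X \<odot>\<^bsub>C\<^esub> Y) = (\<beta> X \<circledast>\<^bsub>C'\<^esub> \<beta> Y) \<Zsemi>\<^bsub>C'\<^esub> FunT H X Y"
    and unt': "FunU G \<Zsemi>\<^bsub>C'\<^esub> \<beta> (Unt C) = FunU H"
    using assms(5) unfolding homotopic_def monoidal_nat_iso_def by blast
  have \<alpha>H: "\<And>X. X \<in> Obj C \<Longrightarrow> \<alpha> X \<in> Hom C' (FunO F X) (FunO G X)"
    and \<beta>H: "\<And>X. X \<in> Obj C \<Longrightarrow> \<beta> X \<in> Hom C' (FunO G X) (FunO H X)"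
    by (rule Iso_Hom [OF \<alpha>], assumption) (rule Iso_Hom [OF \<beta>])
  show ?thesis
    unfolding homotopic_def monoidal_nat_iso_def
  proof (intro exI [of _ "\<lambda>X. \<alpha> X \<Zsemi>\<^bsub>C'\<^esub> \<beta> X"] conjI ballI)
    fix X assume X: "X \<in> Obj C"
    show "\<alpha> X \<Zsemi>\<^bsub>C'\<^esub> \<beta> X \<in> Iso C' (FunO F X) (FunO H X)"
      by (rule F.C'.Iso_Cmp [OF \<alpha> [OF X] \<beta> [OF X]])
    fix Y assume Y: "Y \<in> Obj C"
    show "FunA F f \<Zsemi>\<^bsub>C'\<^esub> (\<alpha> Y \<Zsemi>\<^bsub>C'\<^esub> \<beta> Y) = \<alpha> X \<Zsemi>\<^bsub>C'\<^esub> \<beta> X \<Zsemi>\<^bsub>C'\<^esub> FunA H f" if "f \<in> Hom C X Y" for f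
      by (rule F.C'.square_compose [OF F.FunA_closed G.FunA_closed H.FunA_closed \<alpha>H \<beta>H \<alpha>H \<beta>H nat nat'])
        (use X Y that in auto)
    have "FunT F X Y \<Zsemi>\<^bsub>C'\<^esub> (\<alpha> (X \<odot>\<^bsub>C\<^esub> Y) \<Zsemi>\<^bsub>C'\<^esub> \<beta> (X \<odot>\<^bsub>C\<^esub> Y)) =
        (\<alpha> X \<circledast>\<^bsub>C'\<^esub> \<alpha> Y) \<Zsemi>\<^bsub>C'\<^esub> (\<beta> X \<circledast>\<^bsub>C'\<^esub> \<beta> Y) \<Zsemi>\<^bsub>C'\<^esub> FunT H X Y"
      by (rule F.C'.square_compose [OF Iso_Hom [OF F.FunT_Iso] Iso_Hom [OF G.FunT_Iso] Iso_Hom [OF H.FunT_Iso]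
            F.C'.TenA_closed [OF \<alpha>H \<alpha>H] F.C'.TenA_closed [OF \<beta>H \<beta>H] \<alpha>H \<beta>H mon mon'])
        (use X Y F.C.TenO_closed in auto)
    then show "FunT F X Y \<Zsemi>\<^bsub>C'\<^esub> (\<alpha> (X \<odot>\<^bsub>C\<^esub> Y) \<Zsemi>\<^bsub>C'\<^esub> \<beta> (X \<odot>\<^bsub>C\<^esub> Y)) =
        (\<alpha> X \<Zsemi>\<^bsub>C'\<^esub> \<beta> X) \<circledast>\<^bsub>C'\<^esub> (\<alpha> Y \<Zsemi>\<^bsub>C'\<^esub> \<beta> Y) \<Zsemi>\<^bsub>C'\<^esub> FunT H X Y"
      by (simp only: F.C'.TenA_Cmp [OF \<alpha>H \<beta>H \<alpha>H \<beta>H] X Y)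
  next
    show "FunU F \<Zsemi>\<^bsub>C'\<^esub> (\<alpha> (Unt C) \<Zsemi>\<^bsub>C'\<^esub> \<beta> (Unt C)) = FunU H"
      by (simp only: unt unt'
          F.C'.Cmp_assoc [OF Iso_Hom [OF F.FunU_Iso] \<alpha>H [OF F.C.Unt_closed] \<beta>H [OF F.C.Unt_closed], symmetric])
  qed
qed

theorem equiv_homotopy_rel:
  "equiv (gr_functors_of_type B D d \<theta> Q \<psi>) (homotopy_rel B D d \<theta> Q \<psi>)"
proof -
  have "monoidal_functor (Dis Q) (PP B D d \<theta>) F" if "F \<in> gr_functors_of_type B D d \<theta> Q \<psi>" for F
    using that by (simp add: gr_functors_of_type_def gr_functor_def)
  then show ?thesis
    by (intro equivI refl_onI symI transI)
      (auto simp: homotopy_rel_def intro: homotopic_refl homotopic_sym homotopic_trans)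
qed

lemma short_exact_crossed_module:
  assumes "short_exact B j E p Q"
  shows "crossed_module B E j (conj_action B E j)"
proof -
  interpret B: group B using assms by (simp add: short_exact_def)
  interpret E: group E using assms by (simp add: short_exact_def)
  interpret Q: group Q using assms by (simp add: short_exact_def)
  interpret p: group_hom E Q p using assms by unfold_locales (simp add: short_exact_def)
  have jh: "j \<in> hom B E" and ji: "inj_on j (carrier B)" and ker: "j ` carrier B = kernel E Q p"
    using assms by (simp_all add: short_exact_def)
  interpret j: group_hom B E j using jh by unfold_locales
  have mem: "e \<otimes>\<^bsub>E\<^esub> j b \<otimes>\<^bsub>E\<^esub> inv\<^bsub>E\<^esub> e \<in> j ` carrier B" if "e \<in> carrier E" "b \<in> carrier B" for e b
    using p.normal_kernel that unfolding ker [symmetric]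
    by (simp add: E.normal_inv_iff)
  let ?c = "conj_action B E j"
  have j_c: "j (?c e b) = e \<otimes>\<^bsub>E\<^esub> j b \<otimes>\<^bsub>E\<^esub> inv\<^bsub>E\<^esub> e" and c_cl: "?c e b \<in> carrier B"
    if "e \<in> carrier E" "b \<in> carrier B" for e b
    using mem [OF that] that by (auto simp: conj_action_def f_inv_into_f inv_into_into)
  have eqI: "b = c" if "j b = j c" "b \<in> carrier B" "c \<in> carrier B" for b c
    using ji that by (simp add: inj_on_def)
  have c_mult: "?c e (b \<otimes>\<^bsub>B\<^esub> b') = ?c e b \<otimes>\<^bsub>B\<^esub> ?c e b'"
    if "e \<in> carrier E" "b \<in> carrier B" "b' \<in> carrier B" for e b b'
  proof (rule eqI)
    have "inv\<^bsub>E\<^esub> e \<otimes>\<^bsub>E\<^esub> (e \<otimes>\<^bsub>E\<^esub> (j b' \<otimes>\<^bsub>E\<^esub> inv\<^bsub>E\<^esub> e)) = j b' \<otimes>\<^bsub>E\<^esub> inv\<^bsub>E\<^esub> e"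
      using that by (simp flip: E.m_assoc)
    then show "j (?c e (b \<otimes>\<^bsub>B\<^esub> b')) = j (?c e b \<otimes>\<^bsub>B\<^esub> ?c e b')"
      using that by (simp add: j_c c_cl E.m_assoc)
  qed (use that c_cl in auto)
  have c_comp: "?c (e \<otimes>\<^bsub>E\<^esub> e') b = ?c e (?c e' b)"
    if "e \<in> carrier E" "e' \<in> carrier E" "b \<in> carrier B" for e e' b
    using that by (intro eqI) (auto simp: j_c c_cl E.m_assoc E.inv_mult_group)
  have c_one: "?c \<one>\<^bsub>E\<^esub> b = b" if "b \<in> carrier B" for b
    using that by (intro eqI) (auto simp: j_c c_cl)
  have c_auto: "?c e \<in> auto B" if e: "e \<in> carrier E" for e
  proof -
    have "bij_betw (?c e) (carrier B) (carrier B)"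
      by (rule bij_betw_byWitness [where f' = "?c (inv\<^bsub>E\<^esub> e)"])
        (use e in \<open>auto simp: c_cl c_one simp flip: c_comp\<close>)
    then show ?thesis
      using e by (auto simp: auto_def Bij_def hom_def c_cl c_mult)
        (simp add: conj_action_def)
  qed
  show ?thesis
  proof unfold_locales
    show "j \<in> hom B E" by (rule jh)
    show "?c \<in> hom E (AutoGroup B)"
    proof (rule homI)
      fix e assume "e \<in> carrier E"
      then show "?c e \<in> carrier (AutoGroup B)" using c_auto by (simp add: AutoGroup_def)
    next
      fix e e' assume e: "e \<in> carrier E" "e' \<in> carrier E"
      have "?c (e \<otimes>\<^bsub>E\<^esub> e') = compose (carrier B) (?c e) (?c e')"
        using e by (intro extensionalityI [where A = "carrier B"])
          (auto simp: compose_def c_comp, simp add: conj_action_def)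
      then show "?c (e \<otimes>\<^bsub>E\<^esub> e') = ?c e \<otimes>\<^bsub>AutoGroup B\<^esub> ?c e'"
        using c_auto e by (auto simp: AutoGroup_def BijGroup_def auto_def)
    qed
  next
    fix b c assume "b \<in> carrier B" "c \<in> carrier B"
    then show "?c (j b) c = b \<otimes>\<^bsub>B\<^esub> c \<otimes>\<^bsub>B\<^esub> inv\<^bsub>B\<^esub> b"
      by (intro eqI) (auto simp: j_c c_cl)
  next
    fix x b assume "x \<in> carrier E" "b \<in> carrier B"
    then show "j (?c x b) = x \<otimes>\<^bsub>E\<^esub> j b \<otimes>\<^bsub>E\<^esub> inv\<^bsub>E\<^esub> x" by (rule j_c)
  qed
qed

lemma extension_equiv_refl: "extension_equiv B X X"
  unfolding extension_equiv_def by (rule bexI [of _ id]) (auto simp: hom_def)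

lemma extension_equiv_trans:
  assumes "extension_equiv B X Y" "extension_equiv B Y Z"
  shows "extension_equiv B X Z"
proof -
  obtain \<eta> where \<eta>: "\<eta> \<in> hom (mid X) (mid Y)" "\<forall>b\<in>carrier B. \<eta> (emb X b) = emb Y b"
    "\<forall>e\<in>carrier (mid X). prj Y (\<eta> e) = prj X e" "\<forall>e\<in>carrier (mid X). eps Y (\<eta> e) = eps X e"
    using assms(1) unfolding extension_equiv_def by blast
  obtain \<zeta> where \<zeta>: "\<zeta> \<in> hom (mid Y) (mid Z)" "\<forall>b\<in>carrier B. \<zeta> (emb Y b) = emb Z b"
    "\<forall>e\<in>carrier (mid Y). prj Z (\<zeta> e) = prj Y e" "\<forall>e\<in>carrier (mid Y). eps Z (\<zeta> e) = eps Y e"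
    using assms(2) unfolding extension_equiv_def by blast
  have cl: "\<eta> e \<in> carrier (mid Y)" if "e \<in> carrier (mid X)" for e
    using \<eta>(1) that by (auto simp: hom_def)
  show ?thesis
    unfolding extension_equiv_def
    by (rule bexI [of _ "\<zeta> \<circ> \<eta>"])
      (use \<eta> \<zeta> cl in \<open>auto intro: Group.hom_compose\<close>)
qed

lemma short_five:
  assumes X: "short_exact B j E p Q" and Y: "short_exact B j' E' p' Q"
    and \<eta>: "\<eta> \<in> hom E E'" and j: "\<forall>b\<in>carrier B. \<eta> (j b) = j' b"
    and p: "\<forall>e\<in>carrier E. p' (\<eta> e) = p e"
  shows "bij_betw \<eta> (carrier E) (carrier E')"
proof -
  interpret B: group B using X by (simp add: short_exact_def)
  interpret E: group E using X by (simp add: short_exact_def)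
  interpret E': group E' using Y by (simp add: short_exact_def)
  interpret Q: group Q using X by (simp add: short_exact_def)
  interpret p: group_hom E Q p using X by unfold_locales (simp add: short_exact_def)
  interpret p': group_hom E' Q p' using Y by unfold_locales (simp add: short_exact_def)
  interpret j: group_hom B E j using X by unfold_locales (simp add: short_exact_def)
  interpret j': group_hom B E' j' using Y by unfold_locales (simp add: short_exact_def)
  interpret \<eta>: group_hom E E' \<eta> using \<eta> by unfold_locales
  have "inj_on \<eta> (carrier E)"
  proof -
    have "kernel E E' \<eta> \<subseteq> {\<one>\<^bsub>E\<^esub>}"
    proof
      fix e assume e: "e \<in> kernel E E' \<eta>"
      then have "e \<in> kernel E Q p" using p by (auto simp: kernel_def simp flip: p)
      then obtain b where b: "b \<in> carrier B" "e = j b"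
        using X unfolding short_exact_def by blast
      then have "j' b = j' \<one>\<^bsub>B\<^esub>" using e j by (simp add: kernel_def)
      then have "b = \<one>\<^bsub>B\<^esub>" using Y b by (auto simp: short_exact_def inj_on_def)
      then show "e \<in> {\<one>\<^bsub>E\<^esub>}" using b by simp
    qed
    then have "kernel E E' \<eta> = {\<one>\<^bsub>E\<^esub>}" by (auto simp: kernel_def)
    then show ?thesis by (simp add: \<eta>.inj_iff_trivial_ker)
  qed
  moreover have "e' \<in> \<eta> ` carrier E" if e': "e' \<in> carrier E'" for e'
  proof -
    have "p' e' \<in> p ` carrier E" using X e' by (simp add: short_exact_def)
    then obtain e where e: "e \<in> carrier E" "p e = p' e'" by auto
    then have "inv\<^bsub>E'\<^esub> \<eta> e \<otimes>\<^bsub>E'\<^esub> e' \<in> kernel E' Q p'" using e' p by (simp add: kernel_def)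
    then obtain b where b: "b \<in> carrier B" "inv\<^bsub>E'\<^esub> \<eta> e \<otimes>\<^bsub>E'\<^esub> e' = j' b"
      using Y unfolding short_exact_def by blast
    then have "e' = \<eta> e \<otimes>\<^bsub>E'\<^esub> j' b" using e e' by (metis E'.inv_solve_left' \<eta>.hom_closed j'.hom_closed)
    then have "e' = \<eta> (e \<otimes>\<^bsub>E\<^esub> j b)" using b e j by simp
    moreover have "e \<otimes>\<^bsub>E\<^esub> j b \<in> carrier E" using b e by simp
    ultimately show ?thesis by blast
  qed
  ultimately show ?thesis by (auto simp: bij_betw_def)
qed

lemma extension_equiv_sym:
  assumes X: "extension B D d \<theta> Q X" and Y: "extension B D d \<theta> Q Y" and eq: "extension_equiv B X Y"
  shows "extension_equiv B Y X"
proof -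
  obtain \<eta> where \<eta>: "\<eta> \<in> hom (mid X) (mid Y)" "\<forall>b\<in>carrier B. \<eta> (emb X b) = emb Y b"
    "\<forall>e\<in>carrier (mid X). prj Y (\<eta> e) = prj X e" "\<forall>e\<in>carrier (mid X). eps Y (\<eta> e) = eps X e"
    using eq unfolding extension_equiv_def by blast
  have sX: "short_exact B (emb X) (mid X) (prj X) Q" and sY: "short_exact B (emb Y) (mid Y) (prj Y) Q"
    using X Y by (simp_all add: extension_def)
  have bij: "bij_betw \<eta> (carrier (mid X)) (carrier (mid Y))"
    using short_five [OF sX sY \<eta>(1-3)] .
  let ?\<zeta> = "inv_into (carrier (mid X)) \<eta>"
  have hom: "?\<zeta> \<in> hom (mid Y) (mid X)"
    using group.iso_set_sym [of "mid X" \<eta> "mid Y"] bij \<eta>(1) sX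
    by (auto simp: iso_def short_exact_def)
  have z: "?\<zeta> e \<in> carrier (mid X)" "\<eta> (?\<zeta> e) = e" if "e \<in> carrier (mid Y)" for e
    using bij that by (auto simp: bij_betw_def inv_into_into f_inv_into_f)
  have "?\<zeta> (emb Y b) = emb X b" if "b \<in> carrier B" for b
  proof -
    have "emb X b \<in> carrier (mid X)" using sX that by (auto simp: short_exact_def hom_def)
    then show ?thesis using \<eta>(2) that bij by (metis bij_betw_inv_into_left)
  qed
  then show ?thesis
    unfolding extension_equiv_def using hom z \<eta>(3,4) by (intro bexI [of _ ?\<zeta>]) (auto, metis+)
qed

theorem equiv_extension_rel:
  "equiv (extensions B D d \<theta> Q \<psi>) (extension_rel B D d \<theta> Q \<psi>)"
  by (intro equivI refl_onI symI transI)
    (auto simp: extension_rel_def extensions_def intro: extension_equiv_refl extension_equiv_sym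
       extension_equiv_trans)

theorem extension_small:
  fixes X :: "('b, 'e, 'q, 'd) extension_data"
  assumes X: "X \<in> extensions B D d \<theta> Q \<psi>"
  shows "\<exists>Y :: ('b, 'b \<times> 'q, 'q, 'd) extension_data. Y \<in> extensions B D d \<theta> Q \<psi> \<and> extension_equiv B X Y"
proof -
  define E j p \<epsilon> where "E = mid X" and "j = emb X" and "p = prj X" and "\<epsilon> = eps X"
  have s: "short_exact B j E p Q"
    and m: "crossed_module_morphism B E j (conj_action B E j) B D d \<theta> id \<epsilon>"
    and ind: "induces B D d X \<psi>"
    using X by (simp_all add: extensions_def extension_def E_def j_def p_def \<epsilon>_def)
  interpret E: group E using s by (simp add: short_exact_def)
  interpret Q: group Q using s by (simp add: short_exact_def)
  interpret p: group_hom E Q p using s by unfold_locales (simp add: short_exact_def)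
  define \<sigma> where "\<sigma> = inv_into (carrier E) p"
  have \<sigma>: "\<sigma> (p e) \<in> carrier E" "p (\<sigma> (p e)) = p e" if "e \<in> carrier E" for e
    using that by (auto simp: \<sigma>_def inv_into_into f_inv_into_f)
  define f where "f = (\<lambda>e. (inv_into (carrier B) j (e \<otimes>\<^bsub>E\<^esub> inv\<^bsub>E\<^esub> \<sigma> (p e)), p e))"
  have mem: "e \<otimes>\<^bsub>E\<^esub> inv\<^bsub>E\<^esub> \<sigma> (p e) \<in> j ` carrier B" if "e \<in> carrier E" for e
    using s that \<sigma> by (simp add: short_exact_def kernel_def)
  have f: "inj_on f (carrier E)"
  proof (rule inj_onI)
    fix e e' assume e: "e \<in> carrier E" "e' \<in> carrier E" and "f e = f e'"
    then have pe: "p e = p e'" and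
      "inv_into (carrier B) j (e \<otimes>\<^bsub>E\<^esub> inv\<^bsub>E\<^esub> \<sigma> (p e)) = inv_into (carrier B) j (e' \<otimes>\<^bsub>E\<^esub> inv\<^bsub>E\<^esub> \<sigma> (p e'))"
      by (auto simp: f_def)
    from inv_into_injective [OF this(2) mem mem] e pe
    have "e \<otimes>\<^bsub>E\<^esub> inv\<^bsub>E\<^esub> \<sigma> (p e') = e' \<otimes>\<^bsub>E\<^esub> inv\<^bsub>E\<^esub> \<sigma> (p e')"
      by simp
    then show "e = e'" using e \<sigma> by simp
  qed
  define E' where "E' = image_group f E"
  define g where "g = inv_into (carrier E) f"
  have fi: "f \<in> iso E E'" unfolding E'_def by (rule inj_imp_image_group_iso [OF f])
  have E': "group E'" unfolding E'_def by (rule E.inj_imp_image_group_is_group [OF f])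
  have gi: "g \<in> iso E' E" unfolding g_def by (rule E.iso_set_sym [OF fi])
  have car: "carrier E' = f ` carrier E" by (simp add: E'_def image_group_carrier)
  have gf: "g (f e) = e" if "e \<in> carrier E" for e using f that by (simp add: g_def)
  have fh: "f \<in> hom E E'" and gh: "g \<in> hom E' E" using fi gi by (simp_all add: iso_def)
  have jh: "j \<in> hom B E" and ph: "p \<in> hom E Q" using s by (simp_all add: short_exact_def)
  have jcl: "j b \<in> carrier E" if "b \<in> carrier B" for b using jh that by (auto simp: hom_def)
  interpret f: group_hom E E' f using E' fh by (simp add: group_hom_def group_hom_axioms_def E.is_group)
  have s': "short_exact B (f \<circ> j) E' (p \<circ> g) Q"
    unfolding short_exact_def
  proof (intro conjI)
    show "group B" using s by (simp add: short_exact_def)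
    show "f \<circ> j \<in> hom B E'" using jh fh by (rule Group.hom_compose)
    show "p \<circ> g \<in> hom E' Q" using gh ph by (rule Group.hom_compose)
    have "inj_on j (carrier B)" "j ` carrier B \<subseteq> carrier E" using s jcl by (simp add: short_exact_def) (use jcl in blast)
    then show "inj_on (f \<circ> j) (carrier B)" using f by (blast intro: comp_inj_on inj_on_subset)
    have "kernel E' Q (p \<circ> g) = f ` kernel E Q p" by (auto simp: kernel_def car gf)
    then show "(f \<circ> j) ` carrier B = kernel E' Q (p \<circ> g)" using s by (simp only: short_exact_def image_comp [symmetric])
    have "(p \<circ> g) ` carrier E' = p ` carrier E" by (force simp: car gf image_image)
    then show "(p \<circ> g) ` carrier E' = carrier Q" using s by (simp add: short_exact_def)
  qed (fact E' Q.is_group)+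
  have act: "conj_action B E' (f \<circ> j) (f e) b = conj_action B E j e b"
    if "e \<in> carrier E" "b \<in> carrier B" for e b
  proof -
    interpret C: crossed_module B E j "conj_action B E j" by (rule short_exact_crossed_module [OF s])
    interpret C': crossed_module B E' "f \<circ> j" "conj_action B E' (f \<circ> j)"
      by (rule short_exact_crossed_module [OF s'])
    have fe: "f e \<in> carrier E'" using that by simp
    have eq: "(f \<circ> j) (conj_action B E' (f \<circ> j) (f e) b) = (f \<circ> j) (conj_action B E j e b)"
      using C'.d_theta [OF fe that(2)] that jcl by (simp add: C.d_theta)
    have "inj_on (f \<circ> j) (carrier B)" using s' by (simp add: short_exact_def)
    from this eq C'.theta_closed [OF fe that(2)] C.theta_closed [OF that]
    show ?thesis by (rule inj_onD)
  qed
  define Y where "Y = \<lparr>mid = E', emb = f \<circ> j, prj = p \<circ> g, eps = \<epsilon> \<circ> g\<rparr>"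
  have "crossed_module_morphism B E' (f \<circ> j) (conj_action B E' (f \<circ> j)) B D d \<theta> id (\<epsilon> \<circ> g)"
    using m short_exact_crossed_module [OF s'] gh
    by (auto simp: crossed_module_morphism_def act gf jcl car intro: Group.hom_compose)
  then have "extension B D d \<theta> Q Y" using s' by (simp add: extension_def Y_def)
  moreover have "induces B D d Y \<psi>"
    using ind by (auto simp: induces_def Y_def car gf E_def p_def \<epsilon>_def)
  moreover have "extension_equiv B X Y"
    unfolding extension_equiv_def
    by (rule bexI [of _ f]) (use fh gf in \<open>auto simp: Y_def E_def j_def p_def \<epsilon>_def\<close>)
  ultimately show ?thesis by (auto simp: extensions_def)
qed

end

theory Submission
  imports Defs
begin

text \<open>
  A Gr-functor \<open>F : Dis Q \<rightarrow> \<P>\<close> amounts to a factor set: elements \<open>\<phi> u = F u\<close> of \<open>D\<close> with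
  \<open>\<phi> u \<cdot> \<phi> v = d (f u v) \<cdot> \<phi> (u v)\<close>, where \<open>f\<close> satisfies the cocycle identity, and a unit
  constraint \<open>c\<close>. An extension \<open>E\<close> with a set-theoretic section \<open>s\<close> yields the same data through
  \<open>\<phi> = \<epsilon> \<circ> s\<close> and \<open>s u \<cdot> s v = j (f u v) \<cdot> s (u v)\<close>; conversely the crossed product of \<open>B\<close> and \<open>Q\<close>
  along a factor set is an extension with a section having that factor set. Say that \<open>F\<close> and \<open>E\<close> are
  related if \<open>E\<close> has a section whose factor set is that of \<open>F\<close>. Both homotopies of functors and
  equivalences of related extensions are then cochains \<open>a : Q \<rightarrow> B\<close> relating the two factor sets, so
  the relation induces a bijection on classes.
\<close>

section \<open>Bijections of quotient sets induced by a relation\<close>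

text \<open>Applied with \<open>x = x'\<close>, \<open>iff\<close> puts all partners of
  \<open>x\<close> into one \<open>s\<close>-class, so any choice \<open>g\<close> of partners gives
  the same map on classes. \<open>iff\<close> also makes it injective, and right totality makes it
  surjective.\<close>

lemma quotient_bij_of_relation:
  assumes r: "equiv A r" and s: "equiv B s"
    and left_total: "\<And>x. x \<in> A \<Longrightarrow> \<exists>y\<in>B. R x y"
    and right_total: "\<And>y. y \<in> B \<Longrightarrow> \<exists>x\<in>A. R x y"
    and iff: "\<And>x x' y y'. \<lbrakk>x \<in> A; x' \<in> A; y \<in> B; y' \<in> B; R x y; R x' y'\<rbrakk> \<Longrightarrow>
      (x, x') \<in> r \<longleftrightarrow> (y, y') \<in> s"
  shows "\<exists>\<Omega>. bij_betw \<Omega> (A // r) (B // s)"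
proof -
  obtain g where g: "\<And>x. x \<in> A \<Longrightarrow> g x \<in> B \<and> R x (g x)"
    using left_total by metis
  have g_iff: "s `` {g x} = s `` {g x'} \<longleftrightarrow> r `` {x} = r `` {x'}" if x: "x \<in> A" "x' \<in> A" for x x'
  proof -
    have "(x, x') \<in> r \<longleftrightarrow> (g x, g x') \<in> s"
      using g x by (intro iff) auto
    then show ?thesis
      using g x by (simp add: eq_equiv_class_iff [OF r] eq_equiv_class_iff [OF s])
  qed
  \<comment> \<open>\<open>SOME\<close> picks a representative of the class \<open>K\<close>; by
    \<open>g_iff\<close> the value does not depend on it.\<close>
  define \<Omega> where "\<Omega> = (\<lambda>K. s `` {g (SOME x. x \<in> A \<and> K = r `` {x})})"
  have \<Omega>: "\<Omega> (r `` {x}) = s `` {g x}" if x: "x \<in> A" for x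
  proof -
    let ?y = "SOME y. y \<in> A \<and> r `` {x} = r `` {y}"
    have "?y \<in> A \<and> r `` {x} = r `` {?y}"
      by (rule someI [of _ x]) (simp add: x)
    then have "s `` {g ?y} = s `` {g x}"
      using g_iff [of ?y x] x by simp
    then show ?thesis by (simp add: \<Omega>_def)
  qed
  have "inj_on \<Omega> (A // r)"
  proof (rule inj_onI)
    fix K L assume "K \<in> A // r" "L \<in> A // r" and eq: "\<Omega> K = \<Omega> L"
    then obtain x y where xy: "x \<in> A" "y \<in> A" "K = r `` {x}" "L = r `` {y}"
      by (auto elim!: quotientE)
    with eq show "K = L" by (simp add: \<Omega> g_iff)
  qed
  moreover have "\<Omega> ` (A // r) = B // s"
  proof (intro equalityI subsetI)
    fix L assume "L \<in> \<Omega> ` (A // r)"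
    then obtain x where "x \<in> A" "L = s `` {g x}" by (auto elim!: quotientE simp: \<Omega>)
    then show "L \<in> B // s" using g by (auto intro: quotientI)
  next
    fix L assume "L \<in> B // s"
    then obtain y where y: "y \<in> B" "L = s `` {y}" by (rule quotientE)
    obtain x where x: "x \<in> A" "R x y" using right_total y by blast
    \<comment> \<open>Both \<open>g x\<close> and the given \<open>y\<close> are partners of
      \<open>x\<close>, so reflexivity of \<open>r\<close> puts them into one
      \<open>s\<close>-class.\<close>
    have "(x, x) \<in> r \<longleftrightarrow> (g x, y) \<in> s"
      using g x y by (intro iff) auto
    then have "(g x, y) \<in> s"
      using equiv_class_self [OF r x(1)] by simp
    then have "L = \<Omega> (r `` {x})"
      using y x by (simp add: \<Omega> equiv_class_eq [OF s])
    then show "L \<in> \<Omega> ` (A // r)" using x by (auto intro: quotientI)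
  qed
  ultimately show ?thesis unfolding bij_betw_def by blast
qed

section \<open>Extensions, sections and factor sets\<close>

text \<open>\<open>j_commute\<close> is the equivariance of the crossed-module morphism, multiplied
  on the right by \<open>e\<close>. In this form it avoids \<open>conj_action\<close> and moves
  elements of \<open>B\<close> past elements of \<open>E\<close>.\<close>

locale typed_extension = crossed_module B D d \<theta> + E: group E + Q: group Q
  for B :: "('b, 'm) monoid_scheme" and D :: "('d, 'n) monoid_scheme"
    and d :: "'b \<Rightarrow> 'd" and \<theta> :: "'d \<Rightarrow> 'b \<Rightarrow> 'b"
    and E :: "('e, 'l) monoid_scheme" and Q :: "('q, 'k) monoid_scheme" +
  fixes j :: "'b \<Rightarrow> 'e" and p :: "'e \<Rightarrow> 'q" and \<epsilon> :: "'e \<Rightarrow> 'd"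
  assumes exact: "short_exact B j E p Q"
    and eps_hom: "\<epsilon> \<in> hom E D"
    and eps_j: "b \<in> carrier B \<Longrightarrow> \<epsilon> (j b) = d b"
    and j_commute: "\<lbrakk>e \<in> carrier E; b \<in> carrier B\<rbrakk> \<Longrightarrow> e \<otimes>\<^bsub>E\<^esub> j b = j (\<theta> (\<epsilon> e) b) \<otimes>\<^bsub>E\<^esub> e"
begin

lemma j_hom: "group_hom B E j" and p_hom: "group_hom E Q p" and eps_group_hom: "group_hom E D \<epsilon>"
  using exact eps_hom by unfold_locales (simp_all add: short_exact_def)

lemma p_closed [simp]: "e \<in> carrier E \<Longrightarrow> p e \<in> carrier Q"
  and p_mult [simp]: "\<lbrakk>e \<in> carrier E; e' \<in> carrier E\<rbrakk> \<Longrightarrow> p (e \<otimes>\<^bsub>E\<^esub> e') = p e \<otimes>\<^bsub>Q\<^esub> p e'"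
  and p_one [simp]: "p \<one>\<^bsub>E\<^esub> = \<one>\<^bsub>Q\<^esub>"
  using group_hom.hom_closed [OF p_hom] group_hom.hom_mult [OF p_hom] group_hom.hom_one [OF p_hom] by auto

lemma eps_closed [simp]: "e \<in> carrier E \<Longrightarrow> \<epsilon> e \<in> carrier D"
  and eps_mult [simp]: "\<lbrakk>e \<in> carrier E; e' \<in> carrier E\<rbrakk> \<Longrightarrow> \<epsilon> (e \<otimes>\<^bsub>E\<^esub> e') = \<epsilon> e \<otimes>\<^bsub>D\<^esub> \<epsilon> e'"
  and eps_one [simp]: "\<epsilon> \<one>\<^bsub>E\<^esub> = \<one>\<^bsub>D\<^esub>"
  using group_hom.hom_closed [OF eps_group_hom] group_hom.hom_mult [OF eps_group_hom]
    group_hom.hom_one [OF eps_group_hom] by auto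

lemma j_closed [simp]: "b \<in> carrier B \<Longrightarrow> j b \<in> carrier E"
  and j_mult: "\<lbrakk>b \<in> carrier B; c \<in> carrier B\<rbrakk> \<Longrightarrow> j (b \<otimes>\<^bsub>B\<^esub> c) = j b \<otimes>\<^bsub>E\<^esub> j c"
  and j_one [simp]: "j \<one>\<^bsub>B\<^esub> = \<one>\<^bsub>E\<^esub>"
  using group_hom.hom_closed [OF j_hom] group_hom.hom_mult [OF j_hom] group_hom.hom_one [OF j_hom] by auto

lemma p_j [simp]: "b \<in> carrier B \<Longrightarrow> p (j b) = \<one>\<^bsub>Q\<^esub>"
  using exact by (auto simp: short_exact_def kernel_def)

lemma j_cancel:
  assumes "j b \<otimes>\<^bsub>E\<^esub> e = j c \<otimes>\<^bsub>E\<^esub> e" "b \<in> carrier B" "c \<in> carrier B" "e \<in> carrier E"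
  shows "b = c"
  using assms exact by (auto simp: short_exact_def inj_on_def)

text \<open>The kernel of \<open>p\<close>, which contains \<open>e \<otimes> inv e'\<close>, is the
  image of \<open>j\<close>. The \<open>B\<close>-valued data \<open>f\<close>, \<open>c\<close> and
  \<open>a\<close> taken from extensions below arise this way.\<close>

lemma fibre:
  assumes "e \<in> carrier E" "e' \<in> carrier E" "p e = p e'"
  obtains b where "b \<in> carrier B" "e = j b \<otimes>\<^bsub>E\<^esub> e'"
proof -
  have "e \<otimes>\<^bsub>E\<^esub> inv\<^bsub>E\<^esub> e' \<in> kernel E Q p"
    using assms by (simp add: kernel_def group_hom.hom_inv [OF p_hom])
  then obtain b where b: "b \<in> carrier B" "e \<otimes>\<^bsub>E\<^esub> inv\<^bsub>E\<^esub> e' = j b"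
    using exact unfolding short_exact_def by blast
  then have "e = j b \<otimes>\<^bsub>E\<^esub> e'"
    using assms by (metis E.inv_solve_right' E.inv_closed E.m_closed j_closed)
  with b show thesis by (auto intro: that)
qed

end

text \<open>Exactness alone makes \<open>j\<close> with the conjugation action a crossed module;
  what remains of the definition is that \<open>\<epsilon>\<close> is a homomorphism, that
  \<open>\<epsilon> j = d\<close>, and equivariance.\<close>

lemma (in crossed_module) extension_iff:
  "extension B D d \<theta> Q X \<longleftrightarrow> typed_extension B D d \<theta> (mid X) Q (emb X) (prj X) (eps X)"
proof (cases "short_exact B (emb X) (mid X) (prj X) Q")
  case exact: True
  interpret C: crossed_module B "mid X" "emb X" "conj_action B (mid X) (emb X)"
    by (rule short_exact_crossed_module [OF exact])
  interpret Q: group Q using exact by (simp add: short_exact_def)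
  let ?c = "conj_action B (mid X) (emb X)"
  \<comment> \<open>Injectivity of \<open>emb X\<close> moves the comparison to the middle group,
    where the action is plain conjugation.\<close>
  have act: "?c e b = \<theta> (eps X e) b \<longleftrightarrow>
      e \<otimes>\<^bsub>mid X\<^esub> emb X b = emb X (\<theta> (eps X e) b) \<otimes>\<^bsub>mid X\<^esub> e"
    if "eps X \<in> hom (mid X) D" "e \<in> carrier (mid X)" "b \<in> carrier B" for e b
  proof -
    have \<theta>: "\<theta> (eps X e) b \<in> carrier B"
      by (rule theta_closed [OF hom_in_carrier [OF that(1,2)] that(3)])
    have inj: "inj_on (emb X) (carrier B)" using exact by (simp add: short_exact_def)
    have "?c e b = \<theta> (eps X e) b \<longleftrightarrow> emb X (?c e b) = emb X (\<theta> (eps X e) b)"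
      by (rule inj_on_eq_iff [OF inj C.theta_closed [OF that(2,3)] \<theta>, symmetric])
    also have "\<dots> \<longleftrightarrow> e \<otimes>\<^bsub>mid X\<^esub> emb X b = emb X (\<theta> (eps X e) b) \<otimes>\<^bsub>mid X\<^esub> e"
      unfolding C.d_theta [OF that(2,3)]
      using C.D.inv_solve_right' [OF C.d_closed [OF \<theta>] C.D.m_closed [OF that(2) C.d_closed [OF that(3)]] that(2)]
      by blast
    finally show ?thesis .
  qed
  have id_hom: "(\<lambda>x. x) \<in> hom B B" by (simp add: hom_def)
  show ?thesis
  proof
    assume "extension B D d \<theta> Q X"
    then have m: "eps X \<in> hom (mid X) D" "\<And>b. b \<in> carrier B \<Longrightarrow> eps X (emb X b) = d b"
      "\<And>e b. \<lbrakk>e \<in> carrier (mid X); b \<in> carrier B\<rbrakk> \<Longrightarrow> ?c e b = \<theta> (eps X e) b"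
      by (simp_all only: extension_def crossed_module_morphism_def id_apply)
    show "typed_extension B D d \<theta> (mid X) Q (emb X) (prj X) (eps X)"
      by unfold_locales (rule exact, rule m(1), erule m(2), use m(3) act [OF m(1)] in blast)
  next
    assume "typed_extension B D d \<theta> (mid X) Q (emb X) (prj X) (eps X)"
    then interpret T: typed_extension B D d \<theta> "mid X" Q "emb X" "prj X" "eps X" .
    show "extension B D d \<theta> Q X"
      unfolding extension_def crossed_module_morphism_def id_apply
      by (intro conjI ballI exact C.crossed_module_axioms crossed_module_axioms id_hom T.eps_hom
          T.eps_j iffD2 [OF act [OF T.eps_hom]] T.j_commute)
  qed
next
  case False
  then show ?thesis
    using typed_extension.exact unfolding extension_def by blast
qed

text \<open>These are Gr-functor data read in \<open>B\<close>: \<open>phi_mult\<close> and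
  \<open>phi_one\<close> say that \<open>f u v\<close> and \<open>c\<close> are morphisms of
  \<open>\<P>\<close> with the required ends, \<open>cocycle\<close> is the associativity coherence,
  \<open>lunit\<close> and \<open>runit\<close> are the unit coherences. Nothing forces
  \<open>\<phi> 1 = 1\<close>, so \<open>c\<close> is carried along.\<close>

locale factor_set = crossed_module B D d \<theta> + Q: group Q
  for B :: "('b, 'm) monoid_scheme" and D :: "('d, 'n) monoid_scheme"
    and d :: "'b \<Rightarrow> 'd" and \<theta> :: "'d \<Rightarrow> 'b \<Rightarrow> 'b" and Q :: "('q, 'k) monoid_scheme" +
  fixes \<phi> :: "'q \<Rightarrow> 'd" and f :: "'q \<Rightarrow> 'q \<Rightarrow> 'b" and c :: 'b
  assumes phi_closed [simp]: "u \<in> carrier Q \<Longrightarrow> \<phi> u \<in> carrier D"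
    and f_closed [simp]: "\<lbrakk>u \<in> carrier Q; v \<in> carrier Q\<rbrakk> \<Longrightarrow> f u v \<in> carrier B"
    and c_closed [simp]: "c \<in> carrier B"
    and phi_mult: "\<lbrakk>u \<in> carrier Q; v \<in> carrier Q\<rbrakk> \<Longrightarrow> \<phi> u \<otimes>\<^bsub>D\<^esub> \<phi> v = d (f u v) \<otimes>\<^bsub>D\<^esub> \<phi> (u \<otimes>\<^bsub>Q\<^esub> v)"
    and phi_one: "d c \<otimes>\<^bsub>D\<^esub> \<phi> \<one>\<^bsub>Q\<^esub> = \<one>\<^bsub>D\<^esub>"
    and cocycle: "\<lbrakk>u \<in> carrier Q; v \<in> carrier Q; w \<in> carrier Q\<rbrakk> \<Longrightarrow>
      \<theta> (\<phi> u) (f v w) \<otimes>\<^bsub>B\<^esub> f u (v \<otimes>\<^bsub>Q\<^esub> w) = f u v \<otimes>\<^bsub>B\<^esub> f (u \<otimes>\<^bsub>Q\<^esub> v) w"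
    and lunit: "u \<in> carrier Q \<Longrightarrow> c \<otimes>\<^bsub>B\<^esub> f \<one>\<^bsub>Q\<^esub> u = \<one>\<^bsub>B\<^esub>"
    and runit: "u \<in> carrier Q \<Longrightarrow> \<theta> (\<phi> u) c \<otimes>\<^bsub>B\<^esub> f u \<one>\<^bsub>Q\<^esub> = \<one>\<^bsub>B\<^esub>"

text \<open>\<open>\<phi>\<close>, \<open>f\<close> and \<open>c\<close> are parameters, so that an
  extension can be said to have a section with a prescribed factor set. The section may move the
  unit; \<open>c\<close> records the defect.\<close>

locale extension_section = typed_extension B D d \<theta> E Q j p \<epsilon>
  for B :: "('b, 'm) monoid_scheme" and D :: "('d, 'n) monoid_scheme"
    and d :: "'b \<Rightarrow> 'd" and \<theta> :: "'d \<Rightarrow> 'b \<Rightarrow> 'b"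
    and E :: "('e, 'l) monoid_scheme" and Q :: "('q, 'k) monoid_scheme"
    and j :: "'b \<Rightarrow> 'e" and p :: "'e \<Rightarrow> 'q" and \<epsilon> :: "'e \<Rightarrow> 'd" +
  fixes s :: "'q \<Rightarrow> 'e" and \<phi> :: "'q \<Rightarrow> 'd" and f :: "'q \<Rightarrow> 'q \<Rightarrow> 'b" and c :: 'b
  assumes s_closed [simp]: "u \<in> carrier Q \<Longrightarrow> s u \<in> carrier E"
    and p_s [simp]: "u \<in> carrier Q \<Longrightarrow> p (s u) = u"
    and eps_s [simp]: "u \<in> carrier Q \<Longrightarrow> \<epsilon> (s u) = \<phi> u"
    and f_closed: "\<lbrakk>u \<in> carrier Q; v \<in> carrier Q\<rbrakk> \<Longrightarrow> f u v \<in> carrier B"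
    and c_closed: "c \<in> carrier B"
    and s_mult: "\<lbrakk>u \<in> carrier Q; v \<in> carrier Q\<rbrakk> \<Longrightarrow> s u \<otimes>\<^bsub>E\<^esub> s v = j (f u v) \<otimes>\<^bsub>E\<^esub> s (u \<otimes>\<^bsub>Q\<^esub> v)"
    and s_one: "j c \<otimes>\<^bsub>E\<^esub> s \<one>\<^bsub>Q\<^esub> = \<one>\<^bsub>E\<^esub>"
begin

lemma phi_closed: "u \<in> carrier Q \<Longrightarrow> \<phi> u \<in> carrier D"
  using eps_closed [OF s_closed] by simp

text \<open>\<open>j_commute\<close> carries \<open>j b'\<close> past \<open>s u\<close>, and
  \<open>s_mult\<close> contracts the section values. As all elements of \<open>E\<close> have the
  form \<open>j b \<otimes> s u\<close>, this is the multiplication table of \<open>E\<close> and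
  the model for \<open>crossed_product\<close>.\<close>

lemma js_mult:
  assumes "b \<in> carrier B" "b' \<in> carrier B" "u \<in> carrier Q" "v \<in> carrier Q"
  shows "(j b \<otimes>\<^bsub>E\<^esub> s u) \<otimes>\<^bsub>E\<^esub> (j b' \<otimes>\<^bsub>E\<^esub> s v) =
    j (b \<otimes>\<^bsub>B\<^esub> \<theta> (\<phi> u) b' \<otimes>\<^bsub>B\<^esub> f u v) \<otimes>\<^bsub>E\<^esub> s (u \<otimes>\<^bsub>Q\<^esub> v)"
proof -
  have "(j b \<otimes>\<^bsub>E\<^esub> s u) \<otimes>\<^bsub>E\<^esub> (j b' \<otimes>\<^bsub>E\<^esub> s v) = j b \<otimes>\<^bsub>E\<^esub> (s u \<otimes>\<^bsub>E\<^esub> j b') \<otimes>\<^bsub>E\<^esub> s v"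
    using assms by (simp add: E.m_assoc)
  also have "\<dots> = j b \<otimes>\<^bsub>E\<^esub> j (\<theta> (\<phi> u) b') \<otimes>\<^bsub>E\<^esub> (s u \<otimes>\<^bsub>E\<^esub> s v)"
    using assms by (simp add: j_commute [of "s u" b'] E.m_assoc phi_closed)
  also have "\<dots> = j (b \<otimes>\<^bsub>B\<^esub> \<theta> (\<phi> u) b' \<otimes>\<^bsub>B\<^esub> f u v) \<otimes>\<^bsub>E\<^esub> s (u \<otimes>\<^bsub>Q\<^esub> v)"
    using assms by (simp add: s_mult j_mult E.m_assoc phi_closed f_closed)
  finally show ?thesis .
qed

lemma js_exists:
  assumes "e \<in> carrier E"
  obtains b u where "e = j b \<otimes>\<^bsub>E\<^esub> s u" "b \<in> carrier B" "u \<in> carrier Q"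
proof -
  obtain b where "b \<in> carrier B" "e = j b \<otimes>\<^bsub>E\<^esub> s (p e)"
    by (rule fibre [of e "s (p e)"]) (use assms in auto)
  then show thesis using that assms p_closed by blast
qed

text \<open>Applying \<open>\<epsilon>\<close> to \<open>s_mult\<close> and \<open>s_one\<close>
  gives the equations in \<open>D\<close>. Associativity and the unit laws of \<open>E\<close>,
  written in the form \<open>j b \<otimes> s u\<close> and cancelled, give those in
  \<open>B\<close>.\<close>

lemma factor_set: "factor_set B D d \<theta> Q \<phi> f c"
proof unfold_locales
  fix u v assume u: "u \<in> carrier Q" and v: "v \<in> carrier Q"
  show "\<phi> u \<otimes>\<^bsub>D\<^esub> \<phi> v = d (f u v) \<otimes>\<^bsub>D\<^esub> \<phi> (u \<otimes>\<^bsub>Q\<^esub> v)"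
    using arg_cong [OF s_mult [OF u v], of \<epsilon>] u v by (simp add: eps_j f_closed)
  fix w assume w: "w \<in> carrier Q"
  have "j (\<theta> (\<phi> u) (f v w) \<otimes>\<^bsub>B\<^esub> f u (v \<otimes>\<^bsub>Q\<^esub> w)) \<otimes>\<^bsub>E\<^esub> s (u \<otimes>\<^bsub>Q\<^esub> (v \<otimes>\<^bsub>Q\<^esub> w)) = s u \<otimes>\<^bsub>E\<^esub> (s v \<otimes>\<^bsub>E\<^esub> s w)"
    using js_mult [of "\<one>\<^bsub>B\<^esub>" "f v w" u "v \<otimes>\<^bsub>Q\<^esub> w"] u v w by (simp add: s_mult f_closed phi_closed)
  also have "\<dots> = (s u \<otimes>\<^bsub>E\<^esub> s v) \<otimes>\<^bsub>E\<^esub> s w"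
    using u v w by (simp add: E.m_assoc)
  also have "\<dots> = j (f u v \<otimes>\<^bsub>B\<^esub> f (u \<otimes>\<^bsub>Q\<^esub> v) w) \<otimes>\<^bsub>E\<^esub> s (u \<otimes>\<^bsub>Q\<^esub> (v \<otimes>\<^bsub>Q\<^esub> w))"
    using js_mult [of "f u v" "\<one>\<^bsub>B\<^esub>" "u \<otimes>\<^bsub>Q\<^esub> v" w] u v w
    by (simp add: s_mult f_closed phi_closed Q.m_assoc)
  finally show "\<theta> (\<phi> u) (f v w) \<otimes>\<^bsub>B\<^esub> f u (v \<otimes>\<^bsub>Q\<^esub> w) = f u v \<otimes>\<^bsub>B\<^esub> f (u \<otimes>\<^bsub>Q\<^esub> v) w"
    by (rule j_cancel) (use u v w in \<open>simp_all add: f_closed phi_closed\<close>)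
next
  fix u assume u: "u \<in> carrier Q"
  \<comment> \<open>The unit of \<open>E\<close> is \<open>j c \<otimes> s 1\<close>; multiplying
    \<open>s u\<close> by it on the left, and then on the right, yields the two unit
    identities.\<close>
  show "c \<otimes>\<^bsub>B\<^esub> f \<one>\<^bsub>Q\<^esub> u = \<one>\<^bsub>B\<^esub>"
    by (rule j_cancel [of _ "s u"])
      (use u js_mult [of c "\<one>\<^bsub>B\<^esub>" "\<one>\<^bsub>Q\<^esub>" u] in \<open>simp_all add: s_one f_closed c_closed phi_closed\<close>)
  show "\<theta> (\<phi> u) c \<otimes>\<^bsub>B\<^esub> f u \<one>\<^bsub>Q\<^esub> = \<one>\<^bsub>B\<^esub>"
    by (rule j_cancel [of _ "s u"])
      (use u js_mult [of "\<one>\<^bsub>B\<^esub>" c u "\<one>\<^bsub>Q\<^esub>"] in \<open>simp_all add: s_one f_closed c_closed phi_closed\<close>)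
next
  show "d c \<otimes>\<^bsub>D\<^esub> \<phi> \<one>\<^bsub>Q\<^esub> = \<one>\<^bsub>D\<^esub>"
    using arg_cong [OF s_one, of \<epsilon>] by (simp add: eps_j c_closed)
qed (simp_all add: f_closed c_closed phi_closed)

end

text \<open>Surjectivity of \<open>p\<close> supplies \<open>s\<close> by choice;
  \<open>f u v\<close> and \<open>c\<close> compare two elements of one fibre, and
  \<open>\<phi>\<close> is \<open>\<epsilon> \<circ> s\<close>.\<close>

lemma (in typed_extension) section_exists:
  obtains s \<phi> f c where "extension_section B D d \<theta> E Q j p \<epsilon> s \<phi> f c"
proof -
  have "\<exists>e\<in>carrier E. p e = u" if "u \<in> carrier Q" for u
    using exact that unfolding short_exact_def by (metis imageE)
  then obtain s where s: "\<And>u. u \<in> carrier Q \<Longrightarrow> s u \<in> carrier E \<and> p (s u) = u"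
    by metis
  have "\<exists>b\<in>carrier B. s u \<otimes>\<^bsub>E\<^esub> s v = j b \<otimes>\<^bsub>E\<^esub> s (u \<otimes>\<^bsub>Q\<^esub> v)"
    if "u \<in> carrier Q" "v \<in> carrier Q" for u v
    using fibre [of "s u \<otimes>\<^bsub>E\<^esub> s v" "s (u \<otimes>\<^bsub>Q\<^esub> v)"] that s by auto
  then obtain f where f: "\<And>u v. \<lbrakk>u \<in> carrier Q; v \<in> carrier Q\<rbrakk> \<Longrightarrow>
      f u v \<in> carrier B \<and> s u \<otimes>\<^bsub>E\<^esub> s v = j (f u v) \<otimes>\<^bsub>E\<^esub> s (u \<otimes>\<^bsub>Q\<^esub> v)"
    by metis
  obtain c where c: "c \<in> carrier B" "\<one>\<^bsub>E\<^esub> = j c \<otimes>\<^bsub>E\<^esub> s \<one>\<^bsub>Q\<^esub>"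
    using fibre [of "\<one>\<^bsub>E\<^esub>" "s \<one>\<^bsub>Q\<^esub>"] s by auto
  have "extension_section B D d \<theta> E Q j p \<epsilon> s (\<epsilon> \<circ> s) f c"
    by unfold_locales (use s f c in auto)
  then show thesis by (rule that)
qed

section \<open>Crossed products\<close>

text \<open>As \<open>c\<close> need not be trivial, \<open>u \<mapsto> (1, u)\<close> is not normalised: the unit is \<open>(c, 1)\<close>, and \<open>B\<close> embeds by
  \<open>b \<mapsto> (b c, 1)\<close>.\<close>

definition crossed_product ::
  "('b, 'm) monoid_scheme \<Rightarrow> ('d \<Rightarrow> 'b \<Rightarrow> 'b) \<Rightarrow> ('q, 'k) monoid_scheme \<Rightarrow>
   ('q \<Rightarrow> 'd) \<Rightarrow> ('q \<Rightarrow> 'q \<Rightarrow> 'b) \<Rightarrow> 'b \<Rightarrow> ('b \<times> 'q) monoid"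
  where "crossed_product B \<theta> Q \<phi> f c =
    \<lparr>carrier = carrier B \<times> carrier Q,
     monoid.mult = (\<lambda>(x, u) (y, v). (x \<otimes>\<^bsub>B\<^esub> \<theta> (\<phi> u) y \<otimes>\<^bsub>B\<^esub> f u v, u \<otimes>\<^bsub>Q\<^esub> v)),
     one = (c, \<one>\<^bsub>Q\<^esub>)\<rparr>"

context factor_set
begin

abbreviation "E \<equiv> crossed_product B \<theta> Q \<phi> f c"

lemma carrier_E: "carrier E = carrier B \<times> carrier Q"
  and mult_E: "(x, u) \<otimes>\<^bsub>E\<^esub> (y, v) = (x \<otimes>\<^bsub>B\<^esub> \<theta> (\<phi> u) y \<otimes>\<^bsub>B\<^esub> f u v, u \<otimes>\<^bsub>Q\<^esub> v)"
  and one_E: "\<one>\<^bsub>E\<^esub> = (c, \<one>\<^bsub>Q\<^esub>)"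
  by (simp_all add: crossed_product_def)

lemma phi_one_eq: "\<phi> \<one>\<^bsub>Q\<^esub> = d (inv\<^bsub>B\<^esub> c)"
proof -
  have "inv\<^bsub>D\<^esub> (d c) = \<phi> \<one>\<^bsub>Q\<^esub>"
    by (rule D.inv_equality) (use phi_one D.inv_comm in \<open>simp_all\<close>)
  then show ?thesis by (simp add: d_inv)
qed

lemma f_one_left: "u \<in> carrier Q \<Longrightarrow> f \<one>\<^bsub>Q\<^esub> u = inv\<^bsub>B\<^esub> c"
  using lunit [of u] by (metis B.inv_equality B.inv_comm Q.one_closed c_closed f_closed)

lemma theta_phi_one: "b \<in> carrier B \<Longrightarrow> \<theta> (\<phi> \<one>\<^bsub>Q\<^esub>) b = inv\<^bsub>B\<^esub> c \<otimes>\<^bsub>B\<^esub> b \<otimes>\<^bsub>B\<^esub> c"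
  by (simp add: phi_one_eq theta_d)

text \<open>\<open>\<phi>\<close> is multiplicative up to \<open>d (f u v)\<close>, and
  \<open>\<theta> (d b)\<close> is conjugation by \<open>b\<close>; hence
  \<open>\<theta> \<circ> \<phi>\<close> is multiplicative up to conjugation by
  \<open>f u v\<close>.\<close>

lemma theta_phi_phi:
  assumes "u \<in> carrier Q" "v \<in> carrier Q" "b \<in> carrier B"
  shows "\<theta> (\<phi> u) (\<theta> (\<phi> v) b) \<otimes>\<^bsub>B\<^esub> f u v = f u v \<otimes>\<^bsub>B\<^esub> \<theta> (\<phi> (u \<otimes>\<^bsub>Q\<^esub> v)) b"
proof -
  have "\<theta> (\<phi> u) (\<theta> (\<phi> v) b) = \<theta> (d (f u v) \<otimes>\<^bsub>D\<^esub> \<phi> (u \<otimes>\<^bsub>Q\<^esub> v)) b"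
    using assms by (simp add: phi_mult flip: theta_comp)
  then show ?thesis
    using assms by (simp add: theta_comp theta_d B.m_assoc)
qed

text \<open>\<open>cocycle\<close> rewrites the two trailing \<open>f\<close>-terms, and
  \<open>theta_phi_phi\<close> then moves \<open>f u v\<close> in front of the action on
  \<open>z\<close>.\<close>

lemma E_assoc:
  assumes u: "u \<in> carrier Q" and v: "v \<in> carrier Q" and w: "w \<in> carrier Q"
    and b: "x \<in> carrier B" "y \<in> carrier B" "z \<in> carrier B"
  shows "((x, u) \<otimes>\<^bsub>E\<^esub> (y, v)) \<otimes>\<^bsub>E\<^esub> (z, w) = (x, u) \<otimes>\<^bsub>E\<^esub> ((y, v) \<otimes>\<^bsub>E\<^esub> (z, w))"
proof -
  have "x \<otimes>\<^bsub>B\<^esub> \<theta> (\<phi> u) (y \<otimes>\<^bsub>B\<^esub> \<theta> (\<phi> v) z \<otimes>\<^bsub>B\<^esub> f v w) \<otimes>\<^bsub>B\<^esub> f u (v \<otimes>\<^bsub>Q\<^esub> w)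
      = x \<otimes>\<^bsub>B\<^esub> \<theta> (\<phi> u) y \<otimes>\<^bsub>B\<^esub> \<theta> (\<phi> u) (\<theta> (\<phi> v) z) \<otimes>\<^bsub>B\<^esub> (\<theta> (\<phi> u) (f v w) \<otimes>\<^bsub>B\<^esub> f u (v \<otimes>\<^bsub>Q\<^esub> w))"
    using assms by (simp add: theta_mult B.m_assoc)
  also have "\<dots> = x \<otimes>\<^bsub>B\<^esub> \<theta> (\<phi> u) y \<otimes>\<^bsub>B\<^esub> (\<theta> (\<phi> u) (\<theta> (\<phi> v) z) \<otimes>\<^bsub>B\<^esub> f u v) \<otimes>\<^bsub>B\<^esub> f (u \<otimes>\<^bsub>Q\<^esub> v) w"
    using assms by (simp add: cocycle B.m_assoc)
  also have "\<dots> = x \<otimes>\<^bsub>B\<^esub> \<theta> (\<phi> u) y \<otimes>\<^bsub>B\<^esub> f u v \<otimes>\<^bsub>B\<^esub> \<theta> (\<phi> (u \<otimes>\<^bsub>Q\<^esub> v)) z \<otimes>\<^bsub>B\<^esub> f (u \<otimes>\<^bsub>Q\<^esub> v) w"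
    using assms by (simp add: theta_phi_phi) (simp add: B.m_assoc)
  finally show ?thesis
    using u v w by (simp add: mult_E Q.m_assoc)
qed

lemma group_E: "group E"
proof (rule groupI)
  fix e assume "e \<in> carrier E"
  then obtain b u where e: "e = (b, u)" and bu: "b \<in> carrier B" "u \<in> carrier Q"
    by (auto simp: carrier_E)
  show "\<one>\<^bsub>E\<^esub> \<otimes>\<^bsub>E\<^esub> e = e"
    using bu by (simp add: e one_E mult_E theta_phi_one f_one_left B.m_assoc flip: B.m_assoc [of c "inv\<^bsub>B\<^esub> c"])
  \<comment> \<open>\<open>groupI\<close> asks for left inverses; \<open>?x\<close> solves the
    equation that the first component of the product be \<open>c\<close>.\<close>
  let ?x = "c \<otimes>\<^bsub>B\<^esub> inv\<^bsub>B\<^esub> (\<theta> (\<phi> (inv\<^bsub>Q\<^esub> u)) b \<otimes>\<^bsub>B\<^esub> f (inv\<^bsub>Q\<^esub> u) u)"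
  have "(?x, inv\<^bsub>Q\<^esub> u) \<otimes>\<^bsub>E\<^esub> e = \<one>\<^bsub>E\<^esub>"
    using bu by (simp add: e one_E mult_E B.m_assoc)
  then show "\<exists>e'\<in>carrier E. e' \<otimes>\<^bsub>E\<^esub> e = \<one>\<^bsub>E\<^esub>"
    using bu by (intro bexI [of _ "(?x, inv\<^bsub>Q\<^esub> u)"]) (auto simp: carrier_E)
qed (auto simp: carrier_E one_E E_assoc, auto simp: mult_E)

text \<open>Since \<open>(b, u)\<close> is the image of \<open>b\<close> times
  \<open>(1, u)\<close>, the formula for \<open>\<epsilon>\<close> is forced by
  \<open>\<epsilon> j = d\<close> and \<open>\<epsilon> (1, u) = \<phi> u\<close>.\<close>

lemma section_E:
  "extension_section B D d \<theta> E Q (\<lambda>b. (b \<otimes>\<^bsub>B\<^esub> c, \<one>\<^bsub>Q\<^esub>)) snd (\<lambda>(b, u). d b \<otimes>\<^bsub>D\<^esub> \<phi> u)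
     (\<lambda>u. (\<one>\<^bsub>B\<^esub>, u)) \<phi> f c"
proof -
  interpret E: group E by (rule group_E)
  let ?j = "\<lambda>b. (b \<otimes>\<^bsub>B\<^esub> c, \<one>\<^bsub>Q\<^esub>)" and ?\<epsilon> = "\<lambda>(b, u). d b \<otimes>\<^bsub>D\<^esub> \<phi> u"
  have "c \<otimes>\<^bsub>B\<^esub> (inv\<^bsub>B\<^esub> c \<otimes>\<^bsub>B\<^esub> y) = y" if "y \<in> carrier B" for y
    using that by (simp flip: B.m_assoc)
  \<comment> \<open>The twist by \<open>c\<close> in \<open>?j\<close> cancels against
    \<open>\<phi>\<close> and \<open>f\<close> at the unit; in \<open>mult_j\<close> it cancels by
    \<open>runit\<close>.\<close>
  then have j_mult: "?j b \<otimes>\<^bsub>E\<^esub> (y, v) = (b \<otimes>\<^bsub>B\<^esub> y, v)"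
    if "b \<in> carrier B" "y \<in> carrier B" "v \<in> carrier Q" for b y v
    using that by (simp add: mult_E theta_phi_one f_one_left B.m_assoc)
  have mult_j: "(y, v) \<otimes>\<^bsub>E\<^esub> ?j b = (y \<otimes>\<^bsub>B\<^esub> \<theta> (\<phi> v) b, v)"
    if "b \<in> carrier B" "y \<in> carrier B" "v \<in> carrier Q" for b y v
    using that by (simp add: mult_E theta_mult B.m_assoc runit)
  have exact: "short_exact B ?j E snd Q"
    unfolding short_exact_def
  proof (intro conjI)
    show "?j \<in> hom B E"
      by (auto simp: hom_def carrier_E j_mult B.m_assoc)
    show "snd \<in> hom E Q" by (auto simp: hom_def carrier_E mult_E)
    show "inj_on ?j (carrier B)" by (auto simp: inj_on_def)
    show "?j ` carrier B = kernel E Q snd"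
    proof (intro equalityI subsetI)
      fix e assume "e \<in> kernel E Q snd"
      then obtain b where "b \<in> carrier B" "e = (b, \<one>\<^bsub>Q\<^esub>)" by (auto simp: kernel_def carrier_E)
      then show "e \<in> ?j ` carrier B"
        by (intro image_eqI [of _ _ "b \<otimes>\<^bsub>B\<^esub> inv\<^bsub>B\<^esub> c"]) (simp_all add: B.m_assoc)
    qed (auto simp: kernel_def carrier_E)
    show "snd ` carrier E = carrier Q" by (auto simp: carrier_E intro!: image_eqI [of _ snd "(\<one>\<^bsub>B\<^esub>, _)"])
  qed (fact B.is_group E.is_group Q.is_group)+
  have eps: "?\<epsilon> \<in> hom E D"
  proof (rule homI)
    fix e e' assume "e \<in> carrier E" "e' \<in> carrier E"
    then obtain x u y v where e: "e = (x, u)" "e' = (y, v)"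
      and c: "x \<in> carrier B" "u \<in> carrier Q" "y \<in> carrier B" "v \<in> carrier Q"
      by (auto simp: carrier_E)
    have "?\<epsilon> (e \<otimes>\<^bsub>E\<^esub> e') = d x \<otimes>\<^bsub>D\<^esub> d (\<theta> (\<phi> u) y) \<otimes>\<^bsub>D\<^esub> (d (f u v) \<otimes>\<^bsub>D\<^esub> \<phi> (u \<otimes>\<^bsub>Q\<^esub> v))"
      using c by (simp add: e mult_E d_mult D.m_assoc)
    \<comment> \<open>\<open>d_theta\<close> produces a conjugate by \<open>\<phi> u\<close>, and
      \<open>phi_mult\<close> read backwards supplies the \<open>\<phi> u\<close> that cancels its
      trailing inverse.\<close>
    also have "\<dots> = d x \<otimes>\<^bsub>D\<^esub> (\<phi> u \<otimes>\<^bsub>D\<^esub> d y \<otimes>\<^bsub>D\<^esub> (inv\<^bsub>D\<^esub> \<phi> u \<otimes>\<^bsub>D\<^esub> \<phi> u)) \<otimes>\<^bsub>D\<^esub> \<phi> v"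
      using c by (simp only: d_theta D.m_assoc phi_mult [symmetric] phi_closed d_closed D.m_closed D.inv_closed)
    also have "\<dots> = ?\<epsilon> e \<otimes>\<^bsub>D\<^esub> ?\<epsilon> e'"
      using c by (simp add: e) (simp add: D.m_assoc)
    finally show "?\<epsilon> (e \<otimes>\<^bsub>E\<^esub> e') = ?\<epsilon> e \<otimes>\<^bsub>D\<^esub> ?\<epsilon> e'" .
  qed (auto simp: carrier_E)
  show ?thesis
  proof unfold_locales
    show "short_exact B ?j E snd Q" by (rule exact)
    show "?\<epsilon> \<in> hom E D" by (rule eps)
    show "?\<epsilon> (?j b) = d b" if "b \<in> carrier B" for b
      using that by (simp add: d_mult D.m_assoc phi_one)
    \<comment> \<open>\<open>mult_j\<close> and \<open>j_mult\<close> reduce this to \<open>x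
      \<otimes> \<theta> (\<phi> u) b = \<theta> (d x) (\<theta> (\<phi> u) b) \<otimes> x\<close>,
      where \<open>\<theta> (d x)\<close> is conjugation by \<open>x\<close>.\<close>
    show "e \<otimes>\<^bsub>E\<^esub> ?j b = ?j (\<theta> (?\<epsilon> e) b) \<otimes>\<^bsub>E\<^esub> e" if e: "e \<in> carrier E" and b: "b \<in> carrier B" for e b
    proof -
      obtain x u where "e = (x, u)" "x \<in> carrier B" "u \<in> carrier Q" using e by (auto simp: carrier_E)
      moreover from this have "?j (\<theta> (?\<epsilon> e) b) \<otimes>\<^bsub>E\<^esub> e = (\<theta> (?\<epsilon> e) b \<otimes>\<^bsub>B\<^esub> x, u)"
        using b by (simp only: prod.case) (simp only: j_mult theta_closed D.m_closed d_closed phi_closed)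
      ultimately show ?thesis
        using b by (simp add: mult_j theta_comp theta_d B.m_assoc)
    qed
    show "(\<one>\<^bsub>B\<^esub>, u) \<otimes>\<^bsub>E\<^esub> (\<one>\<^bsub>B\<^esub>, v) = ?j (f u v) \<otimes>\<^bsub>E\<^esub> (\<one>\<^bsub>B\<^esub>, u \<otimes>\<^bsub>Q\<^esub> v)"
      if "u \<in> carrier Q" "v \<in> carrier Q" for u v
      using that by (simp add: j_mult) (simp add: mult_E)
  qed (simp_all add: carrier_E j_mult one_E)
qed

end

section \<open>Equivalence of extensions as cohomology of factor sets\<close>

text \<open>The cochain \<open>a\<close> has two readings: the labels of a monoidal natural
  isomorphism, and the difference in \<open>B\<close> between two sections. \<open>\<phi>'\<close>
  acts on \<open>a v\<close> because the tensor product of \<open>\<P>\<close> twists by the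
  codomain of the first factor.\<close>

definition cohomologous ::
  "('b, 'm) monoid_scheme \<Rightarrow> ('d, 'n) monoid_scheme \<Rightarrow> ('b \<Rightarrow> 'd) \<Rightarrow> ('d \<Rightarrow> 'b \<Rightarrow> 'b) \<Rightarrow> ('q, 'k) monoid_scheme \<Rightarrow>
   ('q \<Rightarrow> 'd) \<Rightarrow> ('q \<Rightarrow> 'q \<Rightarrow> 'b) \<Rightarrow> 'b \<Rightarrow> ('q \<Rightarrow> 'd) \<Rightarrow> ('q \<Rightarrow> 'q \<Rightarrow> 'b) \<Rightarrow> 'b \<Rightarrow> bool"
  where "cohomologous B D d \<theta> Q \<phi> f c \<phi>' f' c' \<longleftrightarrow>
    (\<exists>a. (\<forall>u\<in>carrier Q. a u \<in> carrier B \<and> \<phi> u = d (a u) \<otimes>\<^bsub>D\<^esub> \<phi>' u) \<and>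
         (\<forall>u\<in>carrier Q. \<forall>v\<in>carrier Q.
            f u v \<otimes>\<^bsub>B\<^esub> a (u \<otimes>\<^bsub>Q\<^esub> v) = a u \<otimes>\<^bsub>B\<^esub> \<theta> (\<phi>' u) (a v) \<otimes>\<^bsub>B\<^esub> f' u v) \<and>
         c \<otimes>\<^bsub>B\<^esub> a \<one>\<^bsub>Q\<^esub> = c')"

text \<open>\<open>\<eta> \<circ> s\<close> and \<open>s'\<close> are sections of the same
  \<open>p'\<close>, hence differ by a cochain \<open>a\<close>. The conditions on \<open>a\<close>
  come from applying \<open>\<epsilon>'\<close>, from evaluating
  \<open>\<eta> (s u \<otimes> s v)\<close> in two ways, and from \<open>\<eta>\<close> preserving
  the unit.\<close>

lemma extension_equiv_imp_cohomologous:
  assumes X: "extension_section B D d \<theta> E Q j p \<epsilon> s \<phi> f c"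
    and Y: "extension_section B D d \<theta> E' Q j' p' \<epsilon>' s' \<phi>' f' c'"
    and \<eta>: "\<eta> \<in> hom E E'"
    and \<eta>_j: "\<And>b. b \<in> carrier B \<Longrightarrow> \<eta> (j b) = j' b"
    and \<eta>_p: "\<And>e. e \<in> carrier E \<Longrightarrow> p' (\<eta> e) = p e"
    and \<eta>_eps: "\<And>e. e \<in> carrier E \<Longrightarrow> \<epsilon>' (\<eta> e) = \<epsilon> e"
  shows "cohomologous B D d \<theta> Q \<phi> f c \<phi>' f' c'"
proof -
  interpret X: extension_section B D d \<theta> E Q j p \<epsilon> s \<phi> f c by (rule X)
  interpret Y: extension_section B D d \<theta> E' Q j' p' \<epsilon>' s' \<phi>' f' c' by (rule Y)
  interpret \<eta>: group_hom E E' \<eta> by unfold_locales (rule \<eta>)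
  have "\<exists>b\<in>carrier B. \<eta> (s u) = j' b \<otimes>\<^bsub>E'\<^esub> s' u" if "u \<in> carrier Q" for u
    using Y.fibre [of "\<eta> (s u)" "s' u"] that by (auto simp: \<eta>_p)
  then obtain a where a: "\<And>u. u \<in> carrier Q \<Longrightarrow> a u \<in> carrier B"
    and \<eta>_s: "\<And>u. u \<in> carrier Q \<Longrightarrow> \<eta> (s u) = j' (a u) \<otimes>\<^bsub>E'\<^esub> s' u"
    by metis
  show ?thesis
    unfolding cohomologous_def
  proof (intro exI [of _ a] conjI ballI)
    fix u assume u: "u \<in> carrier Q"
    show "a u \<in> carrier B" by (rule a [OF u])
    show "\<phi> u = d (a u) \<otimes>\<^bsub>D\<^esub> \<phi>' u"
      using \<eta>_eps [of "s u"] u by (simp add: \<eta>_s a Y.eps_j)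
    fix v assume v: "v \<in> carrier Q"
    have "j' (f u v \<otimes>\<^bsub>B\<^esub> a (u \<otimes>\<^bsub>Q\<^esub> v)) \<otimes>\<^bsub>E'\<^esub> s' (u \<otimes>\<^bsub>Q\<^esub> v) = \<eta> (s u \<otimes>\<^bsub>E\<^esub> s v)"
      using u v by (simp add: X.s_mult X.f_closed \<eta>_j \<eta>_s a Y.j_mult Y.E.m_assoc del: \<eta>.hom_mult)
        (simp add: X.f_closed \<eta>_j \<eta>_s a)
    also have "\<dots> = j' (a u \<otimes>\<^bsub>B\<^esub> \<theta> (\<phi>' u) (a v) \<otimes>\<^bsub>B\<^esub> f' u v) \<otimes>\<^bsub>E'\<^esub> s' (u \<otimes>\<^bsub>Q\<^esub> v)"
      using u v by (simp add: \<eta>_s a Y.js_mult)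
    finally show "f u v \<otimes>\<^bsub>B\<^esub> a (u \<otimes>\<^bsub>Q\<^esub> v) = a u \<otimes>\<^bsub>B\<^esub> \<theta> (\<phi>' u) (a v) \<otimes>\<^bsub>B\<^esub> f' u v"
      by (rule Y.j_cancel) (use u v in \<open>simp_all add: a X.f_closed Y.f_closed Y.phi_closed\<close>)
  next
    have "\<eta> (j c \<otimes>\<^bsub>E\<^esub> s \<one>\<^bsub>Q\<^esub>) = j' c' \<otimes>\<^bsub>E'\<^esub> s' \<one>\<^bsub>Q\<^esub>"
      by (simp only: X.s_one Y.s_one \<eta>.hom_one)
    then have "j' (c \<otimes>\<^bsub>B\<^esub> a \<one>\<^bsub>Q\<^esub>) \<otimes>\<^bsub>E'\<^esub> s' \<one>\<^bsub>Q\<^esub> = j' c' \<otimes>\<^bsub>E'\<^esub> s' \<one>\<^bsub>Q\<^esub>"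
      by (simp add: \<eta>_j \<eta>_s a X.c_closed Y.j_mult Y.E.m_assoc)
    then show "c \<otimes>\<^bsub>B\<^esub> a \<one>\<^bsub>Q\<^esub> = c'"
      by (rule Y.j_cancel) (simp_all add: a X.c_closed Y.c_closed)
  qed
qed

text \<open>A homomorphism with \<open>\<eta> (j b) = j' b\<close> and
  \<open>\<eta> (s u) = j' (a u) \<otimes> s' u\<close> must send \<open>j b \<otimes> s u\<close>
  to \<open>j' (b \<otimes> a u) \<otimes> s' u\<close>; this is taken as the definition.\<close>

lemma cohomologous_imp_extension_equiv:
  assumes X: "extension_section B D d \<theta> E Q j p \<epsilon> s \<phi> f c"
    and Y: "extension_section B D d \<theta> E' Q j' p' \<epsilon>' s' \<phi>' f' c'"
    and cohom: "cohomologous B D d \<theta> Q \<phi> f c \<phi>' f' c'"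
  obtains \<eta> where "\<eta> \<in> hom E E'"
    "\<And>b. b \<in> carrier B \<Longrightarrow> \<eta> (j b) = j' b"
    "\<And>e. e \<in> carrier E \<Longrightarrow> p' (\<eta> e) = p e"
    "\<And>e. e \<in> carrier E \<Longrightarrow> \<epsilon>' (\<eta> e) = \<epsilon> e"
proof -
  interpret X: extension_section B D d \<theta> E Q j p \<epsilon> s \<phi> f c by (rule X)
  interpret Y: extension_section B D d \<theta> E' Q j' p' \<epsilon>' s' \<phi>' f' c' by (rule Y)
  obtain a where a: "\<And>u. u \<in> carrier Q \<Longrightarrow> a u \<in> carrier B"
    and phi: "\<And>u. u \<in> carrier Q \<Longrightarrow> \<phi> u = d (a u) \<otimes>\<^bsub>D\<^esub> \<phi>' u"
    and f: "\<And>u v. \<lbrakk>u \<in> carrier Q; v \<in> carrier Q\<rbrakk> \<Longrightarrow>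
      f u v \<otimes>\<^bsub>B\<^esub> a (u \<otimes>\<^bsub>Q\<^esub> v) = a u \<otimes>\<^bsub>B\<^esub> \<theta> (\<phi>' u) (a v) \<otimes>\<^bsub>B\<^esub> f' u v"
    and c: "c \<otimes>\<^bsub>B\<^esub> a \<one>\<^bsub>Q\<^esub> = c'"
    using cohom unfolding cohomologous_def by metis
  \<comment> \<open>\<open>THE\<close> selects the \<open>B\<close>-component of \<open>e\<close>
    over \<open>s (p e)\<close>, unique by \<open>j_cancel\<close>.\<close>
  define \<eta> where "\<eta> = (\<lambda>e. j' ((THE b. b \<in> carrier B \<and> e = j b \<otimes>\<^bsub>E\<^esub> s (p e)) \<otimes>\<^bsub>B\<^esub> a (p e)) \<otimes>\<^bsub>E'\<^esub> s' (p e))"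
  have \<eta>: "\<eta> (j b \<otimes>\<^bsub>E\<^esub> s u) = j' (b \<otimes>\<^bsub>B\<^esub> a u) \<otimes>\<^bsub>E'\<^esub> s' u" if "b \<in> carrier B" "u \<in> carrier Q" for b u
  proof -
    have "(THE b'. b' \<in> carrier B \<and> j b \<otimes>\<^bsub>E\<^esub> s u = j b' \<otimes>\<^bsub>E\<^esub> s u) = b"
      by (rule the_equality) (use that X.j_cancel [of b "s u"] in auto)
    then show ?thesis using that by (simp add: \<eta>_def)
  qed
  \<comment> \<open>\<open>\<phi> u\<close> and \<open>\<phi>' u\<close> differ by
    \<open>d (a u)\<close>, so their actions differ by conjugation by \<open>a u\<close>.\<close>
  have theta_a: "\<theta> (\<phi> u) b \<otimes>\<^bsub>B\<^esub> a u = a u \<otimes>\<^bsub>B\<^esub> \<theta> (\<phi>' u) b" if "b \<in> carrier B" "u \<in> carrier Q" for b u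
    using that by (simp add: phi a Y.phi_closed X.theta_comp X.theta_d X.B.m_assoc)
  show thesis
  proof
    show "\<eta> \<in> hom E E'"
    proof (rule homI)
      fix e assume "e \<in> carrier E"
      then show "\<eta> e \<in> carrier E'"
        by (rule X.js_exists) (simp add: \<eta> a)
      fix e' assume "e' \<in> carrier E"
      obtain x u where e: "e = j x \<otimes>\<^bsub>E\<^esub> s u" and x: "x \<in> carrier B" and u: "u \<in> carrier Q"
        by (rule X.js_exists [OF \<open>e \<in> carrier E\<close>])
      obtain y v where e': "e' = j y \<otimes>\<^bsub>E\<^esub> s v" and y: "y \<in> carrier B" and v: "v \<in> carrier Q"
        by (rule X.js_exists [OF \<open>e' \<in> carrier E\<close>])
      note cl = x u y v a X.f_closed Y.f_closed X.phi_closed Y.phi_closed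
      \<comment> \<open>The chain compares the \<open>B\<close>-components of
        \<open>\<eta> (e \<otimes> e')\<close> and \<open>\<eta> e \<otimes> \<eta> e'\<close>, both
        taken relative to \<open>s'\<close> at the product of \<open>u\<close> and
        \<open>v\<close>.\<close>
      have "x \<otimes>\<^bsub>B\<^esub> \<theta> (\<phi> u) y \<otimes>\<^bsub>B\<^esub> f u v \<otimes>\<^bsub>B\<^esub> a (u \<otimes>\<^bsub>Q\<^esub> v)
          = x \<otimes>\<^bsub>B\<^esub> \<theta> (\<phi> u) y \<otimes>\<^bsub>B\<^esub> (a u \<otimes>\<^bsub>B\<^esub> \<theta> (\<phi>' u) (a v) \<otimes>\<^bsub>B\<^esub> f' u v)"
        using cl by (simp add: X.B.m_assoc f)
      also have "\<dots> = x \<otimes>\<^bsub>B\<^esub> (\<theta> (\<phi> u) y \<otimes>\<^bsub>B\<^esub> a u) \<otimes>\<^bsub>B\<^esub> \<theta> (\<phi>' u) (a v) \<otimes>\<^bsub>B\<^esub> f' u v"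
        using cl by (simp add: X.B.m_assoc)
      also have "\<dots> = x \<otimes>\<^bsub>B\<^esub> a u \<otimes>\<^bsub>B\<^esub> \<theta> (\<phi>' u) (y \<otimes>\<^bsub>B\<^esub> a v) \<otimes>\<^bsub>B\<^esub> f' u v"
        using cl by (simp add: theta_a) (simp add: X.theta_mult X.B.m_assoc)
      finally show "\<eta> (e \<otimes>\<^bsub>E\<^esub> e') = \<eta> e \<otimes>\<^bsub>E'\<^esub> \<eta> e'"
        using cl by (simp add: e e' \<eta> X.js_mult Y.js_mult)
    qed
    show "\<eta> (j b) = j' b" if b: "b \<in> carrier B" for b
    proof -
      \<comment> \<open>Because \<open>j c \<otimes> s 1\<close> is the unit, \<open>j b\<close> has
        component \<open>b \<otimes> c\<close> over \<open>1\<close>; the relation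
        \<open>c \<otimes> a 1 = c'\<close> then gives \<open>j' b\<close>.\<close>
      have "j b = j (b \<otimes>\<^bsub>B\<^esub> c) \<otimes>\<^bsub>E\<^esub> s \<one>\<^bsub>Q\<^esub>"
        using b by (simp add: X.c_closed X.j_mult X.E.m_assoc X.s_one)
      then have "\<eta> (j b) = j' (b \<otimes>\<^bsub>B\<^esub> c \<otimes>\<^bsub>B\<^esub> a \<one>\<^bsub>Q\<^esub>) \<otimes>\<^bsub>E'\<^esub> s' \<one>\<^bsub>Q\<^esub>"
        using b by (simp add: \<eta> X.c_closed)
      also have "\<dots> = j' b"
        using b by (simp add: X.B.m_assoc c X.c_closed a Y.c_closed Y.j_mult Y.E.m_assoc Y.s_one)
      finally show ?thesis .
    qed
    fix e assume "e \<in> carrier E"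
    then obtain x u where e: "e = j x \<otimes>\<^bsub>E\<^esub> s u" and x: "x \<in> carrier B" and u: "u \<in> carrier Q"
      by (rule X.js_exists)
    show "p' (\<eta> e) = p e" "\<epsilon>' (\<eta> e) = \<epsilon> e"
      using x u by (simp_all add: e \<eta> a X.eps_j Y.eps_j X.d_mult phi Y.phi_closed X.D.m_assoc)
  qed
qed

section \<open>Gr-functors from \<open>Dis Q\<close> to \<open>\<P>\<close>\<close>

text \<open>Only the \<open>B\<close>-components of the structure morphisms of a Gr-functor carry information.\<close>

abbreviation label :: "'d \<times> 'b \<times> 'd \<Rightarrow> 'b" where "label t \<equiv> fst (snd t)"

locale crossed_module_over_group = crossed_module B D d \<theta> + Q: group Q
  for B :: "('b, 'm) monoid_scheme" and D :: "('d, 'n) monoid_scheme"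
    and d :: "'b \<Rightarrow> 'd" and \<theta> :: "'d \<Rightarrow> 'b \<Rightarrow> 'b" and Q :: "('q, 'k) monoid_scheme"
begin

abbreviation "\<P> \<equiv> PP B D d \<theta>"

definition factor_functor :: "('q \<Rightarrow> 'd) \<Rightarrow> ('q \<Rightarrow> 'q \<Rightarrow> 'b) \<Rightarrow> 'b \<Rightarrow> ('q, 'q, 'd, 'd \<times> 'b \<times> 'd) monfun"
  where "factor_functor \<phi> f c =
    \<lparr>FunO = \<phi>, FunA = (\<lambda>u. (\<phi> u, \<one>\<^bsub>B\<^esub>, \<phi> u)),
     FunT = (\<lambda>u v. (\<phi> u \<otimes>\<^bsub>D\<^esub> \<phi> v, f u v, \<phi> (u \<otimes>\<^bsub>Q\<^esub> v))),
     FunU = (\<one>\<^bsub>D\<^esub>, c, \<phi> \<one>\<^bsub>Q\<^esub>)\<rparr>"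

lemma gr_functor_factor_functor:
  assumes "factor_set B D d \<theta> Q \<phi> f c"
  shows "gr_functor (Dis Q) \<P> (factor_functor \<phi> f c)"
proof -
  interpret factor_set B D d \<theta> Q \<phi> f c by (rule assms)
  interpret P: gr_category \<P> by (rule gr_category_PP)
  interpret Dis: gr_category "Dis Q" by (rule Q.gr_category_Dis)
  have "monoidal_functor (Dis Q) \<P> (factor_functor \<phi> f c)"
    by unfold_locales
      (auto simp: factor_functor_def Hom_Dis Dis_simps Iso_PP Hom_PP phi_mult phi_one Q.m_assoc D.m_assoc
         cocycle lunit runit split: if_splits)
  then show ?thesis
    by (simp add: gr_functor_def P.gr_category_axioms Dis.gr_category_axioms)
qed

text \<open>Membership in a Hom-set of \<open>\<P>\<close> fixes both ends of a triple, and
  \<open>Dis Q\<close> has only identities, which functors preserve. On \<open>Q\<close>, a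
  Gr-functor is thus determined by \<open>FunO\<close> and the labels of \<open>FunT\<close> and
  \<open>FunU\<close>.\<close>

lemma gr_functor_eq:
  assumes "gr_functor (Dis Q) \<P> F"
  shows "\<And>u. u \<in> carrier Q \<Longrightarrow> FunO F u \<in> carrier D"
    and "\<And>u. u \<in> carrier Q \<Longrightarrow> FunA F u = (FunO F u, \<one>\<^bsub>B\<^esub>, FunO F u)"
    and "\<And>u v. \<lbrakk>u \<in> carrier Q; v \<in> carrier Q\<rbrakk> \<Longrightarrow>
      FunT F u v = (FunO F u \<otimes>\<^bsub>D\<^esub> FunO F v, label (FunT F u v), FunO F (u \<otimes>\<^bsub>Q\<^esub> v))"
    and "FunU F = (\<one>\<^bsub>D\<^esub>, label (FunU F), FunO F \<one>\<^bsub>Q\<^esub>)"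
proof -
  interpret F: monoidal_functor "Dis Q" \<P> F using assms by (simp add: gr_functor_def)
  show "FunO F u \<in> carrier D" "FunA F u = (FunO F u, \<one>\<^bsub>B\<^esub>, FunO F u)" if "u \<in> carrier Q" for u
    using that F.FunO_closed [of u] F.FunA_Idt [of u] by (simp_all add: Dis_simps)
  show "FunT F u v = (FunO F u \<otimes>\<^bsub>D\<^esub> FunO F v, label (FunT F u v), FunO F (u \<otimes>\<^bsub>Q\<^esub> v))"
    if "u \<in> carrier Q" "v \<in> carrier Q" for u v
    using that F.FunT_Iso [of u v] by (auto simp: Dis_simps Iso_PP Hom_PP)
  show "FunU F = (\<one>\<^bsub>D\<^esub>, label (FunU F), FunO F \<one>\<^bsub>Q\<^esub>)"
    using F.FunU_Iso by (auto simp: Dis_simps Iso_PP Hom_PP)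
qed

lemma factor_set_gr_functor:
  assumes F: "gr_functor (Dis Q) \<P> F"
  shows "factor_set B D d \<theta> Q (FunO F) (\<lambda>u v. label (FunT F u v)) (label (FunU F))"
proof -
  interpret F: monoidal_functor "Dis Q" \<P> F using assms by (simp add: gr_functor_def)
  define f where "f u v = label (FunT F u v)" for u v
  define c where "c = label (FunU F)"
  note O = gr_functor_eq(1) [OF F] and A = gr_functor_eq(2) [OF F]
    and T = gr_functor_eq(3) [OF F, folded f_def] and U = gr_functor_eq(4) [OF F, folded c_def]
  have f: "f u v \<in> carrier B" "FunO F u \<otimes>\<^bsub>D\<^esub> FunO F v = d (f u v) \<otimes>\<^bsub>D\<^esub> FunO F (u \<otimes>\<^bsub>Q\<^esub> v)"
    if "u \<in> carrier Q" "v \<in> carrier Q" for u v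
    using that F.FunT_Iso [of u v] by (simp_all add: Dis_simps Iso_PP Hom_PP T)
  have c: "c \<in> carrier B" "d c \<otimes>\<^bsub>D\<^esub> FunO F \<one>\<^bsub>Q\<^esub> = \<one>\<^bsub>D\<^esub>"
    using F.FunU_Iso by (simp_all add: Dis_simps Iso_PP Hom_PP U)
  have "factor_set B D d \<theta> Q (FunO F) f c"
  proof unfold_locales
    fix u v w assume uvw: "u \<in> carrier Q" "v \<in> carrier Q" "w \<in> carrier Q"
    show "\<theta> (FunO F u) (f v w) \<otimes>\<^bsub>B\<^esub> f u (v \<otimes>\<^bsub>Q\<^esub> w) = f u v \<otimes>\<^bsub>B\<^esub> f (u \<otimes>\<^bsub>Q\<^esub> v) w"
      using F.FunT_assoc [of u v w] uvw by (simp add: Dis_simps A T O f)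
  next
    fix u assume u: "u \<in> carrier Q"
    show "c \<otimes>\<^bsub>B\<^esub> f \<one>\<^bsub>Q\<^esub> u = \<one>\<^bsub>B\<^esub>"
      using F.FunT_lunit [of u] u by (simp add: Dis_simps A T U O f c)
    show "\<theta> (FunO F u) c \<otimes>\<^bsub>B\<^esub> f u \<one>\<^bsub>Q\<^esub> = \<one>\<^bsub>B\<^esub>"
      using F.FunT_runit [of u] u by (simp add: Dis_simps A T U O f c)
  qed (simp_all add: O f c)
  then show ?thesis by (simp add: f_def [abs_def] c_def)
qed

text \<open>A component of a homotopy is a triple with fixed ends, hence given by an element
  \<open>a u\<close> of \<open>B\<close>; the monoidal conditions, read in the middle entry, are
  those of \<open>cohomologous\<close>. Invertibility is automatic in \<open>\<P>\<close>.\<close>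

lemma homotopic_iff_cohomologous:
  assumes F: "gr_functor (Dis Q) \<P> F" and G: "gr_functor (Dis Q) \<P> G"
  shows "homotopic (Dis Q) \<P> F G \<longleftrightarrow>
    cohomologous B D d \<theta> Q (FunO F) (\<lambda>u v. label (FunT F u v)) (label (FunU F))
      (FunO G) (\<lambda>u v. label (FunT G u v)) (label (FunU G))"
proof -
  interpret F: factor_set B D d \<theta> Q "FunO F" "\<lambda>u v. label (FunT F u v)" "label (FunU F)"
    by (rule factor_set_gr_functor [OF F])
  interpret G: factor_set B D d \<theta> Q "FunO G" "\<lambda>u v. label (FunT G u v)" "label (FunU G)"
    by (rule factor_set_gr_functor [OF G])
  define f where "f u v = label (FunT F u v)" for u v
  define c where "c = label (FunU F)"
  define f' where "f' u v = label (FunT G u v)" for u v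
  define c' where "c' = label (FunU G)"
  note eqs =
    gr_functor_eq(2) [OF F] gr_functor_eq(3) [OF F, folded f_def] gr_functor_eq(4) [OF F, folded c_def]
    gr_functor_eq(2) [OF G] gr_functor_eq(3) [OF G, folded f'_def] gr_functor_eq(4) [OF G, folded c'_def]
  have "homotopic (Dis Q) \<P> F G \<longleftrightarrow> cohomologous B D d \<theta> Q (FunO F) f c (FunO G) f' c'"
  proof
    assume "homotopic (Dis Q) \<P> F G"
    then obtain \<alpha> where \<alpha>: "\<And>u. u \<in> carrier Q \<Longrightarrow> \<alpha> u \<in> Hom \<P> (FunO F u) (FunO G u)"
      and mon: "\<And>u v. \<lbrakk>u \<in> carrier Q; v \<in> carrier Q\<rbrakk> \<Longrightarrow>
        FunT F u v \<Zsemi>\<^bsub>\<P>\<^esub> \<alpha> (u \<otimes>\<^bsub>Q\<^esub> v) = (\<alpha> u \<circledast>\<^bsub>\<P>\<^esub> \<alpha> v) \<Zsemi>\<^bsub>\<P>\<^esub> FunT G u v"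
      and unt: "FunU F \<Zsemi>\<^bsub>\<P>\<^esub> \<alpha> \<one>\<^bsub>Q\<^esub> = FunU G"
      unfolding homotopic_def monoidal_nat_iso_def Dis_simps Iso_PP by blast
    define a where "a u = label (\<alpha> u)" for u
    have a: "a u \<in> carrier B" "FunO F u = d (a u) \<otimes>\<^bsub>D\<^esub> FunO G u" "\<alpha> u = (FunO F u, a u, FunO G u)"
      if "u \<in> carrier Q" for u
      using \<alpha> [OF that] by (auto simp: a_def Hom_PP)
    show "cohomologous B D d \<theta> Q (FunO F) f c (FunO G) f' c'"
      unfolding cohomologous_def
    proof (intro exI [of _ a] conjI ballI)
      fix u v assume "u \<in> carrier Q" "v \<in> carrier Q"
      then show "f u v \<otimes>\<^bsub>B\<^esub> a (u \<otimes>\<^bsub>Q\<^esub> v) = a u \<otimes>\<^bsub>B\<^esub> \<theta> (FunO G u) (a v) \<otimes>\<^bsub>B\<^esub> f' u v"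
        using mon [of u v] by (simp add: eqs a(3))
    next
      show "c \<otimes>\<^bsub>B\<^esub> a \<one>\<^bsub>Q\<^esub> = c'" using unt by (simp add: eqs a(3))
    qed (fact a)+
  next
    assume "cohomologous B D d \<theta> Q (FunO F) f c (FunO G) f' c'"
    then obtain a where a: "\<And>u. u \<in> carrier Q \<Longrightarrow> a u \<in> carrier B"
      and O: "\<And>u. u \<in> carrier Q \<Longrightarrow> FunO F u = d (a u) \<otimes>\<^bsub>D\<^esub> FunO G u"
      and mon: "\<And>u v. \<lbrakk>u \<in> carrier Q; v \<in> carrier Q\<rbrakk> \<Longrightarrow>
        f u v \<otimes>\<^bsub>B\<^esub> a (u \<otimes>\<^bsub>Q\<^esub> v) = a u \<otimes>\<^bsub>B\<^esub> \<theta> (FunO G u) (a v) \<otimes>\<^bsub>B\<^esub> f' u v"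
      and unt: "c \<otimes>\<^bsub>B\<^esub> a \<one>\<^bsub>Q\<^esub> = c'"
      unfolding cohomologous_def by metis
    show "homotopic (Dis Q) \<P> F G"
      unfolding homotopic_def monoidal_nat_iso_def Dis_simps Iso_PP
    proof (intro exI [of _ "\<lambda>u. (FunO F u, a u, FunO G u)"] conjI ballI)
      fix u assume u: "u \<in> carrier Q"
      show "(FunO F u, a u, FunO G u) \<in> Hom \<P> (FunO F u) (FunO G u)"
        using u a O F.phi_closed G.phi_closed by (intro Hom_PP_I) auto
      fix v assume v: "v \<in> carrier Q"
      \<comment> \<open>A morphism \<open>w\<close> exists only for \<open>u = v\<close> and is then
        an identity, so naturality is trivial.\<close>
      show "FunA F w \<Zsemi>\<^bsub>\<P>\<^esub> (FunO F v, a v, FunO G v) = (FunO F u, a u, FunO G u) \<Zsemi>\<^bsub>\<P>\<^esub> FunA G w"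
        if "w \<in> Hom (Dis Q) u v" for w
        using that u a by (simp add: Hom_Dis eqs split: if_splits)
      show "FunT F u v \<Zsemi>\<^bsub>\<P>\<^esub> (FunO F (u \<otimes>\<^bsub>Q\<^esub> v), a (u \<otimes>\<^bsub>Q\<^esub> v), FunO G (u \<otimes>\<^bsub>Q\<^esub> v)) =
          ((FunO F u, a u, FunO G u) \<circledast>\<^bsub>\<P>\<^esub> (FunO F v, a v, FunO G v)) \<Zsemi>\<^bsub>\<P>\<^esub> FunT G u v"
        using u v by (simp add: eqs mon)
    next
      show "FunU F \<Zsemi>\<^bsub>\<P>\<^esub> (FunO F \<one>\<^bsub>Q\<^esub>, a \<one>\<^bsub>Q\<^esub>, FunO G \<one>\<^bsub>Q\<^esub>) = FunU G"
        by (simp add: eqs unt)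
    qed
  qed
  then show ?thesis by (simp add: f_def [abs_def] c_def f'_def [abs_def] c'_def)
qed

section \<open>Functors realized by extensions\<close>

lemma coker_map_d_mult:
  assumes "b \<in> carrier B" "x \<in> carrier D"
  shows "coker_map B D d (d b \<otimes>\<^bsub>D\<^esub> x) = coker_map B D d x"
proof -
  have sub: "d ` carrier B \<subseteq> carrier D" by auto
  have "d ` carrier B #>\<^bsub>D\<^esub> d b = d ` carrier B"
    using assms by (intro D.coset_join2 subgroup_image) auto
  then show ?thesis
    using assms D.coset_mult_assoc [OF sub d_closed [OF assms(1)] assms(2)] by (simp add: coker_map_def)
qed

text \<open>A relation rather than a map: an extension may have many sections, each with its own
  factor set.\<close>

definition realizes :: "('q, 'q, 'd, 'd \<times> 'b \<times> 'd) monfun \<Rightarrow> ('b, 'e, 'q, 'd) extension_data \<Rightarrow> bool"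
  where "realizes F X \<longleftrightarrow> (\<exists>s. extension_section B D d \<theta> (mid X) Q (emb X) (prj X) (eps X) s
     (FunO F) (\<lambda>u v. label (FunT F u v)) (label (FunU F)))"

text \<open>The witness is the crossed product along the factor set of \<open>F\<close>; its
  elements have the type \<open>'b \<times> 'q\<close> fixed in \<open>Ext\<close>.\<close>

lemma realizing_extension_exists:
  assumes "F \<in> gr_functors_of_type B D d \<theta> Q \<psi>"
  shows "\<exists>X :: ('b, 'b \<times> 'q, 'q, 'd) extension_data. X \<in> extensions B D d \<theta> Q \<psi> \<and> realizes F X"
proof -
  let ?f = "\<lambda>u v. label (FunT F u v)" and ?c = "label (FunU F)"
  have F: "gr_functor (Dis Q) \<P> F" and type: "\<And>u. u \<in> carrier Q \<Longrightarrow> iso_class \<P> (FunO F u) = \<psi> u"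
    using assms by (simp_all add: gr_functors_of_type_def)
  interpret F: factor_set B D d \<theta> Q "FunO F" ?f ?c
    by (rule factor_set_gr_functor [OF F])
  interpret E: extension_section B D d \<theta> F.E Q "\<lambda>b. (b \<otimes>\<^bsub>B\<^esub> ?c, \<one>\<^bsub>Q\<^esub>)" snd
    "\<lambda>(b, u). d b \<otimes>\<^bsub>D\<^esub> FunO F u" "\<lambda>u. (\<one>\<^bsub>B\<^esub>, u)" "FunO F" ?f ?c
    by (rule F.section_E)
  define X where "X = \<lparr>mid = F.E, emb = \<lambda>b. (b \<otimes>\<^bsub>B\<^esub> ?c, \<one>\<^bsub>Q\<^esub>), prj = snd,
    eps = \<lambda>(b, u). d b \<otimes>\<^bsub>D\<^esub> FunO F u\<rparr>"
  have "extension B D d \<theta> Q X"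
    using E.typed_extension_axioms by (simp add: extension_iff X_def)
  \<comment> \<open>At \<open>(b, u)\<close> the value of \<open>\<epsilon>\<close> is
    \<open>d b\<close> times \<open>FunO F u\<close>; the factor \<open>d b\<close> leaves the coset
    unchanged, and the class of \<open>FunO F u\<close> is \<open>\<psi> u\<close>.\<close>
  moreover have "induces B D d X \<psi>"
    by (auto simp: induces_def X_def F.carrier_E coker_map_d_mult iso_class_PP simp flip: type)
  moreover have "realizes F X"
    using F.section_E by (auto simp: realizes_def X_def)
  ultimately show ?thesis by (auto simp: extensions_def)
qed

text \<open>Any section gives a factor set and hence a functor. Its type is \<open>\<psi>\<close>,
  since \<open>\<psi> u = \<psi> (p (s u))\<close> is the coset of
  \<open>\<epsilon> (s u) = \<phi> u\<close>.\<close>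

lemma realized_functor_exists:
  assumes "X \<in> extensions B D d \<theta> Q \<psi>"
  shows "\<exists>F. F \<in> gr_functors_of_type B D d \<theta> Q \<psi> \<and> realizes F X"
proof -
  interpret X: typed_extension B D d \<theta> "mid X" Q "emb X" "prj X" "eps X"
    using assms by (simp add: extensions_def extension_iff)
  obtain s \<phi> f c where "extension_section B D d \<theta> (mid X) Q (emb X) (prj X) (eps X) s \<phi> f c"
    by (rule X.section_exists)
  then interpret S: extension_section B D d \<theta> "mid X" Q "emb X" "prj X" "eps X" s \<phi> f c .
  have "iso_class \<P> (\<phi> u) = \<psi> u" if u: "u \<in> carrier Q" for u
  proof -
    have "\<psi> (prj X (s u)) = coker_map B D d (eps X (s u))"
      using assms S.s_closed [OF u] by (simp add: extensions_def induces_def)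
    then show ?thesis using u by (simp add: iso_class_PP S.phi_closed)
  qed
  then have "factor_functor \<phi> f c \<in> gr_functors_of_type B D d \<theta> Q \<psi>"
    using gr_functor_factor_functor [OF S.factor_set]
    by (simp add: gr_functors_of_type_def) (simp add: factor_functor_def)
  moreover have "realizes (factor_functor \<phi> f c) X"
    using S.extension_section_axioms by (auto simp: realizes_def factor_functor_def)
  ultimately show ?thesis by blast
qed

text \<open>A functor and an extension realizing it share a factor set, so both sides reduce to the
  same instance of \<open>cohomologous\<close>.\<close>

lemma homotopic_iff_extension_equiv:
  assumes "gr_functor (Dis Q) \<P> F" "gr_functor (Dis Q) \<P> G" "realizes F X" "realizes G Y"
  shows "homotopic (Dis Q) \<P> F G \<longleftrightarrow> extension_equiv B X Y"
proof -
  obtain s s' where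
    X: "extension_section B D d \<theta> (mid X) Q (emb X) (prj X) (eps X) s
      (FunO F) (\<lambda>u v. label (FunT F u v)) (label (FunU F))" and
    Y: "extension_section B D d \<theta> (mid Y) Q (emb Y) (prj Y) (eps Y) s'
      (FunO G) (\<lambda>u v. label (FunT G u v)) (label (FunU G))"
    using assms by (auto simp: realizes_def)
  show ?thesis
    unfolding homotopic_iff_cohomologous [OF assms(1,2)]
  proof
    assume "extension_equiv B X Y"
    then obtain \<eta> where "\<eta> \<in> hom (mid X) (mid Y)" "\<And>b. b \<in> carrier B \<Longrightarrow> \<eta> (emb X b) = emb Y b"
      "\<And>e. e \<in> carrier (mid X) \<Longrightarrow> prj Y (\<eta> e) = prj X e"
      "\<And>e. e \<in> carrier (mid X) \<Longrightarrow> eps Y (\<eta> e) = eps X e"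
      unfolding extension_equiv_def by blast
    then show "cohomologous B D d \<theta> Q (FunO F) (\<lambda>u v. label (FunT F u v)) (label (FunU F))
        (FunO G) (\<lambda>u v. label (FunT G u v)) (label (FunU G))"
      by (rule extension_equiv_imp_cohomologous [OF X Y])
  next
    assume "cohomologous B D d \<theta> Q (FunO F) (\<lambda>u v. label (FunT F u v)) (label (FunU F))
        (FunO G) (\<lambda>u v. label (FunT G u v)) (label (FunU G))"
    from cohomologous_imp_extension_equiv [OF X Y this] show "extension_equiv B X Y"
      unfolding extension_equiv_def by metis
  qed
qed

end

section \<open>The bijection between homotopy classes and equivalence classes\<close>

theorem theorem9:
  fixes B :: "('b, 'm) monoid_scheme" and D :: "('d, 'n) monoid_scheme"
    and d :: "'b \<Rightarrow> 'd" and \<theta> :: "'d \<Rightarrow> 'b \<Rightarrow> 'b"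
    and Q :: "('q, 'k) monoid_scheme" and \<psi> :: "'q \<Rightarrow> 'd set"
  assumes "crossed_module B D d \<theta>" and "group Q" and "\<psi> \<in> hom Q (coker B D d)"
  shows "\<exists>\<Omega>. bij_betw \<Omega> (Hom_Dis_PP B D d \<theta> Q \<psi>) (Ext B D d \<theta> Q \<psi>)"
proof -
  interpret crossed_module_over_group B D d \<theta> Q
    using assms by (simp add: crossed_module_over_group_def)
  show ?thesis
    unfolding Hom_Dis_PP_def Ext_def
  \<comment> \<open>\<open>realizes\<close> is total on both sides and matches homotopy with
    equivalence, so it descends to the quotients.\<close>
  proof (rule quotient_bij_of_relation [OF equiv_homotopy_rel equiv_extension_rel, where R = realizes])
    show "\<exists>X\<in>extensions B D d \<theta> Q \<psi> :: ('b, 'b \<times> 'q, 'q, 'd) extension_data set. realizes F X" if "F \<in> gr_functors_of_type B D d \<theta> Q \<psi>" for F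
      using realizing_extension_exists [OF that] by blast
    show "\<exists>F\<in>gr_functors_of_type B D d \<theta> Q \<psi>. realizes F X" if "X \<in> extensions B D d \<theta> Q \<psi>"
      for X :: "('b, 'b \<times> 'q, 'q, 'd) extension_data"
      using realized_functor_exists [OF that] by blast
    fix F G and X Y :: "('b, 'b \<times> 'q, 'q, 'd) extension_data"
    assume *: "F \<in> gr_functors_of_type B D d \<theta> Q \<psi>" "G \<in> gr_functors_of_type B D d \<theta> Q \<psi>"
      "X \<in> extensions B D d \<theta> Q \<psi>" "Y \<in> extensions B D d \<theta> Q \<psi>" "realizes F X" "realizes G Y"
    then have "homotopic (Dis Q) \<P> F G \<longleftrightarrow> extension_equiv B X Y"
      by (intro homotopic_iff_extension_equiv) (auto simp: gr_functors_of_type_def)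
    with * show "(F, G) \<in> homotopy_rel B D d \<theta> Q \<psi> \<longleftrightarrow> (X, Y) \<in> extension_rel B D d \<theta> Q \<psi>"
      by (simp add: homotopy_rel_def extension_rel_def)
  qed
qed

end
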